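(* Let $\lambda$ be an integer and let $G$ be a graph of minimum degree $\delta$. Let $C$ be a longest cycle in $G$, and let $\overline{c}$ denote the length of a longest cycle in $G\setminus C$. If $$\min\{\lambda-1,\ \delta-\lambda+1\}\le \overline{c}\le \max\{\lambda-1,\ \delta-\lambda+1\},$$ then $|C|\ge \lambda(\delta-\lambda+2)$.
   Context: All graphs are finite, undirected, without loops or multiple edges; no connectivity assumption is made on $G$. $|C|$ is the number of edges of $C$. $G\setminus C$ denotes the graph obtained from $G$ by deleting the vertices of $C$. The length of a cycle is its number of edges; by convention a single vertex is regarded as a cycle of length $1$ and a single edge as a cycle of length $2$. If $G\setminus C$ is empty, $\overline{c}=0$. *)

theory Defs
  imports "Graph_Theory.Graph_Theory"
begin

text \<open>
  Finite simple graphs are the symmetric digraphs of locale \<^locale>\<open>graph\<close>. A cycle is given by the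
  list of its vertices in cyclic order, so the length of the list is the length of the cycle.
  In a symmetric loop-free digraph, \<^const>\<open>pre_digraph.cycle\<close> has length at least 2, and those of
  length 2 run along a single edge and back: they are the single edges, regarded as cycles of
  length 2. Single vertices, regarded as cycles of length 1, have to be added.
\<close>

definition cycle_verts :: "('a, 'b) pre_digraph \<Rightarrow> 'a list \<Rightarrow> bool" where
  "cycle_verts G C \<longleftrightarrow>
     (\<exists>v \<in> verts G. C = [v]) \<or> (\<exists>p. pre_digraph.cycle G p \<and> C = map (tail G) p)"

definition longest_cycle :: "('a, 'b) pre_digraph \<Rightarrow> 'a list \<Rightarrow> bool" where
  "longest_cycle G C \<longleftrightarrow> cycle_verts G C \<and> (\<forall>D. cycle_verts G D \<longrightarrow> length D \<le> length C)"

definition longest_cycle_length :: "('a, 'b) pre_digraph \<Rightarrow> nat" where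
  "longest_cycle_length G =
     (if verts G = {} then 0 else Max {length D | D. cycle_verts G D})"

text \<open>
  In a graph, each edge at \<open>v\<close> contributes exactly one arc leaving \<open>v\<close>, so \<^const>\<open>out_degree\<close> is the
  degree. The minimum is only meaningful for a nonempty vertex set.
\<close>

definition min_degree :: "('a, 'b) pre_digraph \<Rightarrow> nat" where
  "min_degree G = Min (out_degree G ` verts G)"

lemma cycle_verts_iff_vpath:
  assumes "graph G"
  shows "cycle_verts G C \<longleftrightarrow> vpath C G \<and> (2 \<le> length C \<longrightarrow> last C \<rightarrow>\<^bsub>G\<^esub> hd C)"
proof
  interpret graph G by fact
  have arcs: "set (vwalk_arcs (map (tail G) p)) \<subseteq> arcs_ends G"
    if "set p \<subseteq> arcs G" "cas u p v" for u p v
    using that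
  proof (induct p arbitrary: u)
    case (Cons e p)
    show ?case
    proof (cases p)
      case (Cons f q)
      with Cons.prems have "tail G f = head G e" by simp
      with Cons Cons.prems Cons.hyps[of "head G e"] show ?thesis
        by (auto simp: arcs_ends_conv)
    qed simp
  qed simp
  assume "cycle_verts G C"
  then consider v where "v \<in> verts G" "C = [v]"
    | p where "cycle p" "C = map (tail G) p" by (auto simp: cycle_verts_def)
  then show "vpath C G \<and> (2 \<le> length C \<longrightarrow> last C \<rightarrow>\<^bsub>G\<^esub> hd C)"
  proof cases
    case 1 then show ?thesis by (auto simp: vpath_def vwalk_def)
  next
    case 2
    then obtain u where u: "awalk u p u" "distinct (tl (awalk_verts u p))" "p \<noteq> []"
      by (auto simp: cycle_def)
    then have c: "set p \<subseteq> arcs G" "cas u p u" by (auto simp: awalk_def)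
    have eq: "map (tail G) p @ [head G (last p)] = tail G (hd p) # map (head G) p"
      using awalk_verts_conv'[OF c(2)] awalk_verts_conv[of u p] u(3) by simp
    have hd: "head G (last p) = tail G (hd p)"
      using c(2) u(3) awlast_if_cas[OF c(2)] awhd_if_cas[OF c(2)]
      by (auto simp: awalk_verts_conv hd_map)
    have "distinct (tl (map (tail G) p @ [head G (last p)]))"
      using u by (simp add: awalk_verts_conv)
    then have "distinct (tl (map (tail G) p) @ [hd (map (tail G) p)])"
      using u(3) hd by (simp add: hd_map)
    then have d: "distinct C" using 2 u(3) by (cases p) auto
    have "(tail G (last p), head G (last p)) \<in> arcs_ends G"
      using c(1) last_in_set[OF u(3)] by (auto simp: arcs_ends_conv)
    moreover have "last C = tail G (last p)" "hd C = head G (last p)"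
      using 2 u(3) hd by (auto simp: last_map hd_map)
    ultimately show ?thesis
      using d arcs[OF c] 2 u(3) c(1) by (auto simp: vpath_def vwalk_def)
  qed
next
  interpret graph G by fact
  assume C: "vpath C G \<and> (2 \<le> length C \<longrightarrow> last C \<rightarrow>\<^bsub>G\<^esub> hd C)"
  have walk: "\<exists>p. awalk (hd xs) p w \<and> map (tail G) p = xs"
    if "vwalk xs G" "last xs \<rightarrow>\<^bsub>G\<^esub> w" for xs w
    using that
  proof (induct xs)
    case (Base u)
    then obtain e where "e \<in> arcs G" "tail G e = u" "head G e = w"
      by (auto simp: arcs_ends_conv)
    then show ?case by (intro exI[of _ "[e]"]) (auto simp: awalk_def)
  next
    case (Cons u v es)
    then obtain p where p: "awalk v p w" "map (tail G) p = v # es" by auto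
    obtain e where "e \<in> arcs G" "tail G e = u" "head G e = v"
      using Cons by (auto simp: arcs_ends_conv)
    then show ?case using p
      by (intro exI[of _ "e # p"]) (auto simp: awalk_def)
  qed
  show "cycle_verts G C"
  proof (cases "2 \<le> length C")
    case True
    with C walk obtain p where p: "awalk (hd C) p (hd C)" "map (tail G) p = C"
      by (auto simp: vpath_def)
    then have ne: "p \<noteq> []" using True by auto
    have "cas (hd C) p (hd C)" using p(1) by (simp add: awalk_def)
    from awlast_if_cas[OF this] have "head G (last p) = hd C"
      using ne by (simp add: awalk_verts_conv)
    then have "distinct (tl (awalk_verts (hd C) p))"
      using C p ne by (cases C) (auto simp: awalk_verts_conv vpath_def)
    with p ne show ?thesis by (auto simp: cycle_verts_def cycle_def)
  next
    case False
    with C obtain v where "C = [v]"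
      by (cases C) (auto simp: vpath_def vwalk_def Suc_le_eq)
    with C show ?thesis by (auto simp: cycle_verts_def vpath_def vwalk_def)
  qed
qed

lemma longest_cycle_length_eq:
  assumes "graph G" "longest_cycle G C"
  shows "longest_cycle_length G = length C"
proof -
  have "verts G \<noteq> {}"
    using assms by (auto simp: longest_cycle_def cycle_verts_iff_vpath vpath_def vwalk_def)
  moreover have "Max {length D | D. cycle_verts G D} = length C"
  proof (rule Max_eqI)
    show "finite {length D | D. cycle_verts G D}"
      using assms by - (rule finite_subset[of _ "{..length C}"], auto simp: longest_cycle_def)
  qed (use assms in \<open>auto simp: longest_cycle_def\<close>)
  ultimately show ?thesis by (simp add: longest_cycle_length_def)
qed

lemma longest_cycle_exists:
  assumes "graph G" "verts G \<noteq> {}"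
  shows "\<exists>C. longest_cycle G C"
proof -
  interpret graph G by fact
  obtain v where v: "v \<in> verts G" using assms by auto
  have "length D \<le> card (verts G)" if "cycle_verts G D" for D
    using that assms
    by (auto simp: cycle_verts_iff_vpath vpath_def vwalk_def distinct_card[symmetric]
        intro!: card_mono)
  moreover have "cycle_verts G [v]" using v by (auto simp: cycle_verts_def)
  ultimately show ?thesis
    using ex_has_greatest_nat[of "cycle_verts G" "[v]" length "Suc (card (verts G))"]
    by (auto simp: longest_cycle_def less_Suc_eq_le)
qed

end

theory Submission
  imports Defs
begin

text \<open>
  Let \<open>c\<close> be the length of a longest cycle \<open>Q = u\<^sub>0 \<dots> u\<^sub>c\<^sub>-\<^sub>1\<close> of \<open>H = G - C\<close>. As
  \<open>c + 1\<close> lies between \<open>\<lambda>\<close> and \<open>\<delta> - \<lambda> + 2\<close>, it suffices to show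
  \<open>|C| \<ge> (c + 1) (\<delta> - c + 1)\<close>.

  To every \<open>u\<^sub>i\<close> we assign a vertex \<open>w\<^sub>i\<close> of \<open>H\<close> such that the degrees of the \<open>w\<^sub>i\<close> in \<open>H\<close>
  sum up to at most \<open>c (c - 1)\<close>, and such that for all nonempty index sets \<open>M\<close>, \<open>N\<close> some \<open>w\<^sub>i\<close>,
  \<open>i \<in> M\<close>, and some \<open>w\<^sub>k\<close>, \<open>k \<in> N\<close>, are joined in \<open>H\<close> by a path with at least \<open>(|M| + |N|) / 2\<close>
  vertices. If \<open>p\<close> and \<open>q\<close> are vertices of \<open>C\<close> with \<open>m(p)\<close> and \<open>m(q)\<close> neighbours among the \<open>w\<^sub>i\<close>,
  such a path is an ear of \<open>C\<close>, so \<open>p\<close> and \<open>q\<close> are at distance at least \<open>(m(p) + m(q)) / 2 + 1\<close>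
  on \<open>C\<close>. Summing over consecutive vertices with \<open>m > 0\<close> yields \<open>|C| \<ge> \<Sum> (m(p) + 1)\<close>, where
  \<open>\<Sum> m(p) \<ge> c (\<delta> - c + 1)\<close>, and at least \<open>\<delta> - c + 1\<close> vertices contribute.

  For the \<open>w\<^sub>i\<close>, choose disjoint paths in \<open>H\<close> starting at the \<open>u\<^sub>i\<close>, with as many vertices as
  possible on nontrivial paths. The end of a nontrivial path has degree at most \<open>c / 2\<close>, or all its
  neighbours lie on that path. A trivial \<open>u\<^sub>i\<close> can have degree greater than \<open>c - 1\<close> only because it is
  adjacent to the second vertices of some nontrivial paths. If the end of such a path has degree at
  most \<open>c / 2\<close>, it makes up for the excess. Otherwise the rotations of the path have at least as many
  ends as its second vertex has neighbours on \<open>Q\<close>, all of degree at most \<open>c - 1\<close> and on a common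
  cycle, and one of these ends is taken for \<open>w\<^sub>i\<close>. In all other cases \<open>w\<^sub>i\<close> is the end of the path starting at \<open>u\<^sub>i\<close>.
\<close>

subsection \<open>Distances on a cycle\<close>

text \<open>At most one of the two truncated differences is nonzero, so this is the absolute
  difference. Positions \<open>p\<close> and \<open>q\<close> split a cycle of length
  \<open>n\<close> into arcs with \<open>gap p q\<close> and \<open>n - gap p q\<close>
  edges.\<close>

definition gap :: "nat \<Rightarrow> nat \<Rightarrow> nat" where
  "gap p q = (p - q) + (q - p)"

lemma gap_commute: "gap p q = gap q p"
  by (simp add: gap_def)

text \<open>Adding the hypothesis over consecutive elements of \<open>P\<close> makes the distances
  telescope and counts every inner value of \<open>f\<close> twice, the two extreme ones
  once.\<close>

lemma sum_le_span:
  fixes f :: "nat \<Rightarrow> nat"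
  assumes "finite P" "P \<noteq> {}"
    and "\<And>p q. p \<in> P \<Longrightarrow> q \<in> P \<Longrightarrow> p < q \<Longrightarrow> f p + f q \<le> 2 * (q - p)"
  shows "2 * sum f P \<le> 2 * (Max P - Min P) + f (Min P) + f (Max P)"
  using assms
proof (induction P rule: finite_linorder_max_induct)
  case (insert b A)
  show ?case
  proof (cases "A = {}")
    case False
    have IH: "2 * sum f A \<le> 2 * (Max A - Min A) + f (Min A) + f (Max A)"
      using insert False by auto
    have b: "Max A < b" "Min A \<le> Max A" using insert False by auto
    have "f (Max A) + f b \<le> 2 * (b - Max A)"
      using insert False b by (auto intro!: insert.prems)
    moreover have "Max (insert b A) = max b (Max A)" "Min (insert b A) = min b (Min A)"
      using insert(1) False by simp_all
    then have "Max (insert b A) = b" "Min (insert b A) = Min A" using b by linarith+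
    moreover have "b \<notin> A" using insert by auto
    ultimately show ?thesis using IH b insert(1) by simp
  qed simp
qed simp

text \<open>The pair \<open>Min P\<close>, \<open>Max P\<close> also bounds the arc that wraps
  around, which closes the sum of \<open>sum_le_span\<close> to the full cycle. A one-element
  \<open>P\<close> offers no pair, hence the separate hypothesis.\<close>

lemma sum_le_cycle_length:
  fixes f :: "nat \<Rightarrow> nat"
  assumes P: "P \<subseteq> {..<n}"
    and gap: "\<And>p q. p \<in> P \<Longrightarrow> q \<in> P \<Longrightarrow> p \<noteq> q \<Longrightarrow>
      f p + f q \<le> 2 * gap p q \<and> f p + f q + 2 * gap p q \<le> 2 * n"
    and single: "\<And>p. P = {p} \<Longrightarrow> f p \<le> n"
  shows "sum f P \<le> n"
proof -
  have fin: "finite P" using P finite_subset by blast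
  consider "P = {}" | p where "P = {p}" | "P \<noteq> {}" "Min P \<noteq> Max P"
  proof (cases "P \<noteq> {} \<and> Min P = Max P")
    case True
    then have "x = Min P" if "x \<in> P" for x
      using fin that by (metis Max_ge Min_le order_antisym)
    with True show ?thesis using that(2)[of "Min P"] by blast
  qed (use that in blast)
  then show ?thesis
  proof cases
    case 3
    have "2 * sum f P \<le> 2 * (Max P - Min P) + f (Min P) + f (Max P)"
      using sum_le_span[OF fin 3(1), of f] gap by (fastforce simp: gap_def)
    moreover have "f (Min P) + f (Max P) + 2 * gap (Min P) (Max P) \<le> 2 * n"
      using gap fin 3 by auto
    moreover have "Min P \<le> Max P" using fin 3 by auto
    ultimately show ?thesis by (simp add: gap_def)
  qed (use single in auto)
qed

text \<open>On a cycle of length \<open>L\<close>, the longer arc between \<open>i\<close> and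
  \<open>k\<close> has \<open>max (gap i k) (L - gap i k) + 1\<close> vertices. With
  \<open>k\<close> fixed in the smaller set, too few positions have a longer arc to \<open>k\<close>
  that is short to accommodate the whole larger set.\<close>

lemma exists_far_pair:
  fixes M N :: "nat set"
  assumes M: "M \<subseteq> {..<L}" "M \<noteq> {}" and N: "N \<subseteq> {..<L}" "N \<noteq> {}"
    and ne: "\<not> (\<exists>i. M = {i} \<and> N = {i})"
  shows "\<exists>i\<in>M. \<exists>k\<in>N. i \<noteq> k \<and> card M + card N \<le> 2 * (max (gap i k) (L - gap i k) + 1)"
proof -
  have wlog: "\<exists>i\<in>M. \<exists>k\<in>N. i \<noteq> k \<and> card M \<le> max (gap i k) (L - gap i k) + 1"
    if M: "M \<subseteq> {..<L}" "M \<noteq> {}" and N: "N \<subseteq> {..<L}" "N \<noteq> {}"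
      and ne: "\<not> (\<exists>i. M = {i} \<and> N = {i})" and le: "card N \<le> card M" for M N
  proof (rule ccontr)
    assume neg: "\<not> ?thesis"
    have fin: "finite M" "finite N" using M N finite_subset by auto
    have cM: "card M \<le> L" using card_mono[OF _ M(1)] by simp
    obtain k where k: "k \<in> N" using N by auto
    have m1: "card M > 0" using M fin by auto
    show False
    proof (cases "card M = 1")
      case True
      moreover from this have "card N = 1" using le N fin
        by (metis One_nat_def card_gt_0_iff le_antisym Suc_leI)
      ultimately obtain i j where "M = {i}" "N = {j}" by (auto simp: card_1_singleton_iff)
      with ne neg True show False by auto
    next
      case False
      define m where "m = card M"
      have m2: "2 \<le> m" using False m1 by (simp add: m_def)
      have kL: "k < L" using k N by auto
      \<comment> \<open>The negated claim forces \<open>L - gap i k \<le> m - 2\<close>, so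
        \<open>i\<close> is at distance at least \<open>L + 2 - m\<close> from \<open>k\<close>, to
        the left or to the right. Since \<open>m \<le> L\<close>, fewer than \<open>m - 1\<close>
        positions are that far away.\<close>
      have sub: "M - {k} \<subseteq> {i. i + L + 2 \<le> k + m} \<union> {k + L + 2 - m..<L}"
      proof
        fix i assume i: "i \<in> M - {k}"
        then have "\<not> m \<le> max (gap i k) (L - gap i k) + 1" using neg k by (auto simp: m_def)
        moreover have "i < L" using i M by auto
        ultimately show "i \<in> {i. i + L + 2 \<le> k + m} \<union> {k + L + 2 - m..<L}"
          using i kL by (auto simp: gap_def max_def split: if_splits)
      qed
      have eq: "{i. i + L + 2 \<le> k + m} = {..<k + m - (L + 1)}" by auto
      have "card (M - {k}) \<le> card ({..<k + m - (L + 1)} \<union> {k + L + 2 - m..<L})"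
        using sub unfolding eq by (intro card_mono) auto
      also have "\<dots> \<le> (k + m - (L + 1)) + (L - (k + L + 2 - m))"
        using card_Un_le[of "{..<k + m - (L + 1)}" "{k + L + 2 - m..<L}"] by simp
      also have "\<dots> < m - 1" using m2 kL cM by (auto simp: m_def)
      finally have "card (M - {k}) < m - 1" .
      moreover have "m - 1 \<le> card (M - {k})"
        using fin by (auto simp: m_def card_Diff_singleton_if)
      ultimately show False by simp
    qed
  qed
  show ?thesis
  proof (cases "card N \<le> card M")
    case True
    from wlog[OF M N ne this] True show ?thesis by fastforce
  next
    case False
    have "\<not> (\<exists>i. N = {i} \<and> M = {i})" using ne by auto
    from wlog[OF N M this] False obtain k i where "k \<in> N" "i \<in> M" "k \<noteq> i"
      "card N \<le> max (gap k i) (L - gap k i) + 1" by auto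
    with False show ?thesis by (intro bexI[of _ i] bexI[of _ k]) (auto simp: gap_commute[of k i])
  qed
qed

subsection \<open>Paths, cycles and ears\<close>

definition adj_path :: "('a \<Rightarrow> 'a \<Rightarrow> bool) \<Rightarrow> 'a list \<Rightarrow> bool" where
  "adj_path adj xs \<longleftrightarrow> xs \<noteq> [] \<and> distinct xs \<and> successively adj xs"

text \<open>The guard admits a single vertex as a cycle. For two vertices the closing edge is the
  same edge traversed back, so a single edge is a cycle too.\<close>

definition adj_cycle :: "('a \<Rightarrow> 'a \<Rightarrow> bool) \<Rightarrow> 'a list \<Rightarrow> bool" where
  "adj_cycle adj xs \<longleftrightarrow> adj_path adj xs \<and> (2 \<le> length xs \<longrightarrow> adj (last xs) (hd xs))"

locale adjacency =
  fixes adj :: "'a \<Rightarrow> 'a \<Rightarrow> bool"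
  assumes adj_sym: "adj u v \<Longrightarrow> adj v u"
    and adj_irrefl: "\<not> adj u u"
begin

abbreviation "path \<equiv> adj_path adj"
abbreviation "cyc \<equiv> adj_cycle adj"

lemma adj_commute: "adj u v \<longleftrightarrow> adj v u"
  using adj_sym by blast

lemma successively_adj_flip [simp]: "successively (\<lambda>x y. adj y x) xs \<longleftrightarrow> successively adj xs"
  using adj_commute by (metis successively_mono)

lemma path_rev: "path xs \<Longrightarrow> path (rev xs)"
  by (simp add: adj_path_def)

lemma path_append:
  assumes "path xs" "path ys" "set xs \<inter> set ys = {}" "adj (last xs) (hd ys)"
  shows "path (xs @ ys)"
  using assms by (auto simp: adj_path_def successively_append_iff)

lemma path_take: "path xs \<Longrightarrow> 0 < k \<Longrightarrow> path (take k xs)"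
  unfolding adj_path_def
  by (metis append_take_drop_id distinct_take gr_implies_not0 successively_append_iff take_eq_Nil)

lemma path_drop: "path xs \<Longrightarrow> k < length xs \<Longrightarrow> path (drop k xs)"
  unfolding adj_path_def
  by (metis append_take_drop_id distinct_drop drop_eq_Nil linorder_not_less successively_append_iff)

lemma cycle_arc_less:
  assumes C: "cyc C" and pq: "p < q" "q < length C" and l: "l = q - p \<or> l = length C - (q - p)"
  obtains ys where "path ys" "hd ys = C ! p" "last ys = C ! q" "set ys \<subseteq> set C" "length ys = Suc l"
proof -
  have pC: "path C" and close: "adj (last C) (hd C)" using C pq by (auto simp: adj_cycle_def)
  from l show ?thesis
  proof
    assume l: "l = q - p"
    let ?ys = "drop p (take (Suc q) C)"
    have "path ?ys" using pC pq by (intro path_drop path_take) auto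
    moreover have "hd ?ys = C ! p" "last ?ys = C ! q"
      using pq by (auto simp: hd_drop_conv_nth take_Suc_conv_app_nth)
    moreover have "set ?ys \<subseteq> set C" by (meson dual_order.trans set_drop_subset set_take_subset)
    ultimately show ?thesis using that[of ?ys] pq l by simp
  next
    assume l: "l = length C - (q - p)"
    \<comment> \<open>Backwards from position \<open>p\<close> to 0, over the closing edge, and
      backwards from the last position to \<open>q\<close>.\<close>
    let ?ys = "rev (take (Suc p) C) @ rev (drop q C)"
    have disj: "set (take (Suc p) C) \<inter> set (drop q C) = {}"
      using set_take_disj_set_drop_if_distinct[of C "Suc p" q] pC pq by (simp add: adj_path_def)
    have "adj (last (rev (take (Suc p) C))) (hd (rev (drop q C)))"
      using close pq adj_sym
      by (cases C) (auto simp: hd_rev last_rev hd_take last_drop)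
    then have "path ?ys" using pC pq disj
      by (intro path_append path_rev path_take path_drop) auto
    moreover have "hd ?ys = C ! p" "last ?ys = C ! q"
      using pq by (auto simp: hd_append hd_rev last_rev hd_drop_conv_nth take_Suc_conv_app_nth)
    moreover have "set ?ys \<subseteq> set C" using set_drop_subset set_take_subset by fastforce
    ultimately show ?thesis using that[of ?ys] pq l by simp
  qed
qed

lemma cycle_arc:
  assumes C: "cyc C" and pq: "p < length C" "q < length C" "p \<noteq> q"
    and l: "l = gap p q \<or> l = length C - gap p q"
  obtains ys where "path ys" "hd ys = C ! p" "last ys = C ! q" "set ys \<subseteq> set C" "length ys = Suc l"
proof (cases "p < q")
  case True
  then show ?thesis using cycle_arc_less[OF C True, of l] pq l that by (auto simp: gap_def)
next
  case False
  then have "q < p" using pq by simp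
  then obtain ys where "path ys" "hd ys = C ! q" "last ys = C ! p" "set ys \<subseteq> set C" "length ys = Suc l"
    using cycle_arc_less[OF C, of q p l] pq l by (auto simp: gap_def)
  then show ?thesis using that[of "rev ys"] by (auto simp: path_rev hd_rev last_rev adj_path_def)
qed

text \<open>Relative to a vertex set, so that one relation \<open>adj\<close> serves both the whole
  graph and what remains after deleting a cycle.\<close>

definition longest_in :: "'a set \<Rightarrow> 'a list \<Rightarrow> bool" where
  "longest_in S C \<longleftrightarrow> cyc C \<and> set C \<subseteq> S \<and> (\<forall>D. cyc D \<and> set D \<subseteq> S \<longrightarrow> length D \<le> length C)"

text \<open>Replacing either arc between the attachment positions by the ear yields a cycle in
  \<open>S\<close>, which is no longer than \<open>C\<close>; the two arcs give the two
  inequalities.\<close>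

lemma longest_ear:
  assumes C: "longest_in S C" and pq: "p < length C" "q < length C" "p \<noteq> q"
    and xs: "path xs" "set xs \<subseteq> S - set C" "adj (C ! p) (hd xs)" "adj (last xs) (C ! q)"
  shows "length xs < gap p q \<and> length xs + gap p q < length C"
proof -
  have *: "Suc l + length xs \<le> length C" if l: "l = gap p q \<or> l = length C - gap p q" for l
  proof -
    have cC: "cyc C" using C by (simp add: longest_in_def)
    obtain ys where ys: "path ys" "hd ys = C ! p" "last ys = C ! q" "set ys \<subseteq> set C" "length ys = Suc l"
      using cycle_arc[OF cC pq l] by blast
    have ne: "xs \<noteq> []" "ys \<noteq> []" using xs ys by (auto simp: adj_path_def)
    have "path (ys @ rev xs)"
      using xs ys ne adj_sym by (intro path_append path_rev) (auto simp: hd_rev)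
    then have "cyc (ys @ rev xs)"
      using xs ys ne adj_sym by (auto simp: adj_cycle_def last_rev)
    moreover have "set (ys @ rev xs) \<subseteq> S" using ys xs C by (auto simp: longest_in_def)
    ultimately have "length (ys @ rev xs) \<le> length C" using C unfolding longest_in_def by blast
    then show ?thesis using ys by simp
  qed
  have "gap p q < length C" using pq by (auto simp: gap_def)
  then show ?thesis using *[of "gap p q"] *[of "length C - gap p q"] by linarith
qed

text \<open>Here the list includes both attachment vertices; stripping them off leaves the situation
  of \<open>longest_ear\<close>, with two vertices less.\<close>

lemma longest_ear_path:
  assumes C: "longest_in S C" and pq: "p < length C" "q < length C" "p \<noteq> q"
    and zs: "path zs" "set zs \<subseteq> S" "set zs \<inter> set C = {C ! p, C ! q}"
      "hd zs = C ! p" "last zs = C ! q" "3 \<le> length zs"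
  shows "length zs \<le> gap p q + 1 \<and> length zs + gap p q \<le> length C + 1"
proof -
  obtain ys where ys: "zs = C ! p # ys" using zs by (cases zs) auto
  then have "ys \<noteq> []" "last ys = C ! q" using zs(5,6) by (cases ys; simp)+
  then obtain xs where "ys = xs @ [C ! q]" by (metis append_butlast_last_id)
  with ys have zs_eq: "zs = C ! p # xs @ [C ! q]" by simp
  then have ne: "xs \<noteq> []" using zs by auto
  have d: "C ! p \<notin> set xs" "C ! q \<notin> set xs" using zs(1) by (auto simp: zs_eq adj_path_def)
  have "length xs < gap p q \<and> length xs + gap p q < length C"
  proof (rule longest_ear[OF C pq])
    show "path xs" "adj (C ! p) (hd xs)" "adj (last xs) (C ! q)"
      using zs(1) ne by (auto simp: zs_eq adj_path_def successively_Cons successively_append_iff)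
    have "x \<in> set zs" if "x \<in> set xs" for x using that by (simp add: zs_eq)
    moreover have "x \<noteq> C ! p \<and> x \<noteq> C ! q" if "x \<in> set xs" for x using that d by auto
    moreover have "x \<in> S \<and> (x \<in> set C \<longrightarrow> x = C ! p \<or> x = C ! q)" if "x \<in> set zs" for x
      using that zs(2) equalityD1[OF zs(3)] by auto
    ultimately show "set xs \<subseteq> S - set C" by (metis DiffI subsetI)
  qed
  then show ?thesis by (simp add: zs_eq)
qed

text \<open>From the end of \<open>F\<close> back to the cycle, along an arc with \<open>l\<close>
  edges, and out along \<open>F'\<close>. The arc shares its ends with \<open>F\<close> and
  \<open>F'\<close>, hence the \<open>+ 1\<close>.\<close>

lemma cycle_join:
  assumes C: "cyc C" and pq: "p < length C" "q < length C" "p \<noteq> q"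
    and F: "path F" "hd F = C ! p" "set F \<inter> set C = {C ! p}"
    and F': "path F'" "hd F' = C ! q" "set F' \<inter> set C = {C ! q}"
    and disj: "set F \<inter> set F' = {}"
    and l: "l = gap p q \<or> l = length C - gap p q"
  obtains zs where "path zs" "hd zs = last F" "last zs = last F'"
    "set zs \<subseteq> set F \<union> set F' \<union> set C" "length zs + 1 = length F + length F' + l"
proof -
  obtain ys where ys: "path ys" "hd ys = C ! p" "last ys = C ! q" "set ys \<subseteq> set C" "length ys = Suc l"
    using cycle_arc[OF C pq l] by blast
  obtain G where G: "F = C ! p # G" using F by (cases F) (auto simp: adj_path_def)
  obtain G' where G': "F' = C ! q # G'" using F' by (cases F') (auto simp: adj_path_def)
  have "C ! p \<in> set C" "C ! q \<in> set C" using pq by auto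
  then have Gd: "set G \<inter> set C = {}" "set G' \<inter> set C = {}" "set G \<inter> set G' = {}"
    using F F' disj unfolding G G' adj_path_def by auto
  have ne: "ys \<noteq> []" using ys by (auto simp: adj_path_def)
  let ?zs = "rev G @ ys @ G'"
  have "distinct ?zs" using F F' G G' ys Gd by (auto simp: adj_path_def)
  moreover have "successively adj ?zs"
    using F(1) F'(1) ys ne adj_sym
    by (auto simp: G G' adj_path_def successively_append_iff successively_Cons last_rev hd_append)
  ultimately have "path ?zs" using ne by (simp add: adj_path_def)
  moreover have "hd ?zs = last F" "last ?zs = last F'"
    using ys ne by (auto simp: G G' hd_append hd_rev)
  moreover have "set ?zs \<subseteq> set F \<union> set F' \<union> set C" using ys by (auto simp: G G')
  ultimately show ?thesis using that[of ?zs] ys by (simp add: G G')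
qed

end

subsection \<open>Maximal systems of disjoint paths starting on a longest cycle\<close>

locale longest_cycle_system = adjacency +
  fixes S :: "'a set" and Q :: "'a list"
  assumes finite_S: "finite S"
    and longest_Q: "longest_in S Q"
begin

definition nbrs :: "'a \<Rightarrow> 'a set" where
  "nbrs v = {y \<in> S. adj v y}"

lemma finite_nbrs [simp]: "finite (nbrs v)"
  using finite_S by (simp add: nbrs_def)

lemma Q_cycle: "cyc Q" "set Q \<subseteq> S" "distinct Q" "Q \<noteq> []"
  using longest_Q by (auto simp: longest_in_def adj_cycle_def adj_path_def)

lemma cycle_length_le: "cyc D \<Longrightarrow> set D \<subseteq> S \<Longrightarrow> length D \<le> length Q"
  using longest_Q by (auto simp: longest_in_def)

definition linkage :: "(nat \<Rightarrow> 'a list) \<Rightarrow> bool" where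
  "linkage E \<longleftrightarrow>
     (\<forall>i<length Q. path (E i) \<and> hd (E i) = Q ! i \<and> set (E i) \<subseteq> S) \<and>
     (\<forall>i<length Q. \<forall>k<length Q. i \<noteq> k \<longrightarrow> set (E i) \<inter> set (E k) = {})"

definition wt :: "'a list \<Rightarrow> nat" where
  "wt xs = (if length xs \<le> 1 then 0 else length xs)"

definition weight :: "(nat \<Rightarrow> 'a list) \<Rightarrow> nat" where
  "weight E = (\<Sum>i<length Q. wt (E i))"

definition maximal :: "(nat \<Rightarrow> 'a list) \<Rightarrow> bool" where
  "maximal E \<longleftrightarrow> linkage E \<and> (\<forall>E'. linkage E' \<longrightarrow> weight E' \<le> weight E)"

lemma weight_upd: "i < length Q \<Longrightarrow> weight (E(i := xs)) + wt (E i) = weight E + wt xs"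
  by (simp add: weight_def sum.remove[of "{..<length Q}" i])

lemma linkage_path:
  assumes "linkage E" "i < length Q"
  shows "path (E i)" "hd (E i) = Q ! i" "set (E i) \<subseteq> S" "0 < length (E i)" "E i \<noteq> []"
  using assms by (auto simp: linkage_def adj_path_def)

lemma linkage_disjoint:
  assumes "linkage E" "i < length Q" "k < length Q" "i \<noteq> k"
  shows "set (E i) \<inter> set (E k) = {}"
  using assms by (auto simp: linkage_def)

lemma linkage_eq:
  assumes "linkage E" "i < length Q"
  shows "E i = Q ! i # tl (E i)" "E i ! 0 = Q ! i" "Q ! i \<in> set (E i)"
  using linkage_path[OF assms] by (metis list.collapse, metis hd_conv_nth, metis hd_in_set)

text \<open>Every vertex of \<open>Q\<close> is the root of its own path, and distinct paths are
  disjoint.\<close>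

lemma linkage_Int_Q:
  assumes "linkage E" "i < length Q"
  shows "set (E i) \<inter> set Q = {Q ! i}"
proof -
  have "y = Q ! i" if "y \<in> set (E i)" "y \<in> set Q" for y
  proof -
    from that(2) obtain k where "k < length Q" "y = Q ! k" by (metis in_set_conv_nth)
    then show ?thesis
      using linkage_disjoint[OF assms(1,2), of k] linkage_eq(3)[OF assms(1), of k] that by fastforce
  qed
  moreover have "Q ! i \<in> set (E i)" "Q ! i \<in> set Q"
    using linkage_eq(3)[OF assms] nth_mem[OF assms(2)] .
  ultimately show ?thesis by blast
qed

lemma linkage_nth_notin_Q:
  assumes "linkage E" "i < length Q" "0 < d" "d < length (E i)"
  shows "E i ! d \<notin> set Q"
proof
  assume "E i ! d \<in> set Q"
  moreover have "E i ! d \<in> set (E i)" using assms by simp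
  ultimately have "E i ! d = E i ! 0"
    using linkage_Int_Q[OF assms(1,2)] linkage_eq(2)[OF assms(1,2)] by auto
  moreover have "distinct (E i)" using linkage_path(1)[OF assms(1,2)] by (simp add: adj_path_def)
  ultimately show False using assms(3,4) linkage_path(5)[OF assms(1,2)] nth_eq_iff_index_eq[of "E i" d 0] by auto
qed

lemma linkageI_upd:
  assumes "linkage E" "i < length Q" "path xs" "hd xs = Q ! i" "set xs \<subseteq> S"
    and "\<And>k. k < length Q \<Longrightarrow> k \<noteq> i \<Longrightarrow> set xs \<inter> set (E k) = {}"
  shows "linkage (E(i := xs))"
proof -
  have "set ((E(i := xs)) a) \<inter> set ((E(i := xs)) b) = {}"
    if "a < length Q" "b < length Q" "a \<noteq> b" for a b
    using that assms(6)[of a] assms(6)[of b] linkage_disjoint[OF assms(1) that]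
    by (auto simp: Int_commute)
  moreover have "path ((E(i := xs)) a) \<and> hd ((E(i := xs)) a) = Q ! a \<and> set ((E(i := xs)) a) \<subseteq> S"
    if "a < length Q" for a
    using that assms linkage_path[OF assms(1) that] by auto
  ultimately show ?thesis unfolding linkage_def by blast
qed

lemma exists_maximal: "\<exists>E. maximal E"
proof -
  have l: "linkage (\<lambda>i. [Q ! i])"
    using Q_cycle by (auto simp: linkage_def adj_path_def nth_eq_iff_index_eq)
  have b: "weight E \<le> length Q * card S" if "linkage E" for E
  proof -
    have "wt (E i) \<le> card S" if "i < length Q" for i
      using linkage_path[OF \<open>linkage E\<close> that] finite_S
      by (auto simp: wt_def adj_path_def distinct_card[symmetric] intro: card_mono)
    then have "weight E \<le> (\<Sum>i<length Q. card S)" unfolding weight_def by (intro sum_mono) auto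
    then show ?thesis by simp
  qed
  show ?thesis
    using ex_has_greatest_nat[of linkage _ weight "Suc (length Q * card S)", OF l] b
    by (auto simp: maximal_def less_Suc_eq_le)
qed

lemma maximal_linkage: "maximal E \<Longrightarrow> linkage E"
  by (simp add: maximal_def)

text \<open>A neighbour on none of the paths could be appended to \<open>E i\<close>, which raises
  the weight (from 0 to 2 if \<open>E i\<close> is trivial).\<close>

lemma maximal_end_nbr:
  assumes E: "maximal E" and i: "i < length Q" and y: "y \<in> nbrs (last (E i))"
  shows "\<exists>k<length Q. y \<in> set (E k)"
proof (rule ccontr)
  assume neg: "\<not> ?thesis"
  note l = maximal_linkage[OF E]
  note p = linkage_path[OF l i]
  have "path (E i @ [y])"
    using p y neg i by (intro path_append) (auto simp: adj_path_def nbrs_def)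
  then have "linkage (E(i := E i @ [y]))"
    using p y neg i linkage_disjoint[OF l i]
    by (intro linkageI_upd[OF l i]) (auto simp: nbrs_def)
  then have "weight (E(i := E i @ [y])) \<le> weight E" using E by (simp add: maximal_def)
  moreover have "wt (E i) < wt (E i @ [y])" using p by (auto simp: wt_def)
  ultimately show False using weight_upd[OF i, of E "E i @ [y]"] by simp
qed

text \<open>The weight counts the root of a path as soon as the path is nontrivial, so moving the tail of
  a path to a trivial one increases it, provided both parts remain nontrivial.\<close>

lemma maximal_trivial_nbr:
  assumes E: "maximal E" and i: "i < length Q" and triv: "length (E i) = 1" and y: "y \<in> nbrs (Q ! i)"
  shows "y \<in> set Q \<or> (\<exists>k<length Q. 1 < length (E k) \<and> y = E k ! 1)"
proof (rule ccontr)
  assume neg: "\<not> ?thesis"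
  note l = maximal_linkage[OF E]
  have Ei: "E i = [Q ! i]" using triv linkage_eq(1)[OF l i] by (cases "E i") auto
  from maximal_end_nbr[OF E i, of y] y Ei obtain k where k: "k < length Q" "y \<in> set (E k)" by auto
  then obtain d where d: "d < length (E k)" "y = E k ! d" by (metis in_set_conv_nth)
  note p = linkage_path[OF l k(1)]
  have yQ: "y \<notin> set Q" using neg by blast
  have "d \<noteq> 0" using yQ d k linkage_eq(2)[OF l k(1)] by (metis nth_mem)
  moreover have "d \<noteq> 1" using neg d k by auto
  ultimately have d2: "2 \<le> d" by simp
  have ki: "k \<noteq> i" using d d2 triv by auto
  \<comment> \<open>Cut \<open>E k\<close> just before \<open>y\<close> and attach the part from
    \<open>y\<close> on to \<open>Q ! i\<close>. As \<open>2 \<le> d\<close>, both resulting paths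
    have at least two vertices.\<close>
  let ?A = "take d (E k)" and ?B = "drop d (E k)"
  have AB: "set ?A \<inter> set ?B = {}"
    using p(1) by (intro set_take_disj_set_drop_if_distinct) (auto simp: adj_path_def)
  have sub: "set ?A \<subseteq> set (E k)" "set ?B \<subseteq> set (E k)" by (auto dest: in_set_takeD in_set_dropD)
  have l1: "linkage (E(k := ?A))"
  proof (rule linkageI_upd[OF l k(1)])
    show "path ?A" using p d2 by (intro path_take) auto
    show "hd ?A = Q ! k" using p d2 by (simp add: hd_take)
    show "set ?A \<subseteq> S" using sub p by blast
    show "set ?A \<inter> set (E k') = {}" if "k' < length Q" "k' \<noteq> k" for k'
      using linkage_disjoint[OF l k(1) that(1)] that sub by blast
  qed
  have l2: "linkage (E(k := ?A, i := Q ! i # ?B))"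
  proof (rule linkageI_upd[OF l1 i])
    have "path ([Q ! i] @ ?B)"
    proof (rule path_append)
      show "set [Q ! i] \<inter> set ?B = {}"
        using linkage_disjoint[OF l i k(1)] ki sub Ei by auto
      show "adj (last [Q ! i]) (hd ?B)" using d y by (simp add: hd_drop_conv_nth nbrs_def)
      show "path ?B" using p(1) d(1) by (rule path_drop)
    qed (simp add: adj_path_def)
    then show "path (Q ! i # ?B)" by simp
    show "set (Q ! i # ?B) \<subseteq> S" using Q_cycle i sub p by auto
    show "set (Q ! i # ?B) \<inter> set ((E(k := ?A)) k') = {}" if k': "k' < length Q" "k' \<noteq> i" for k'
    proof (cases "k' = k")
      case True
      have "Q ! i \<notin> set ?A" using linkage_disjoint[OF l i k(1)] ki sub Ei by auto
      with True AB show ?thesis by auto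
    next
      case False
      have "Q ! i \<notin> set (E k')" using linkage_disjoint[OF l i k'(1)] k' Ei by auto
      moreover have "set ?B \<inter> set (E k') = {}"
        using linkage_disjoint[OF l k(1) k'(1)] False sub by blast
      ultimately show ?thesis using False by auto
    qed
  qed simp
  have "weight (E(k := ?A, i := Q ! i # ?B)) \<le> weight E" using E l2 by (simp add: maximal_def)
  moreover have "weight (E(k := ?A, i := Q ! i # ?B)) + wt (E i) = weight (E(k := ?A)) + wt (Q ! i # ?B)"
    using weight_upd[OF i, of "E(k := ?A)" "Q ! i # ?B"] ki by simp
  moreover have "weight (E(k := ?A)) + wt (E k) = weight E + wt ?A" using weight_upd[OF k(1)] by blast
  \<comment> \<open>All vertices of \<open>E k\<close> still count and \<open>Q ! i\<close> counts
    in addition, so the weight grows by 1.\<close>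
  moreover have "wt (E i) = 0" "wt (Q ! i # ?B) = Suc (length (E k) - d)" "wt ?A = d" "wt (E k) = length (E k)"
    using triv d d2 by (auto simp: wt_def)
  ultimately show False using d by simp
qed

lemma own_path_cycle:
  assumes es: "path es" "set es \<subseteq> S" and x: "x < length es - 1" "adj (last es) (es ! x)"
  shows "cyc (drop x es)"
proof -
  have "path (drop x es)" using es x by (intro path_drop) auto
  moreover have "last (drop x es) = last es" "hd (drop x es) = es ! x"
    using x by (auto simp: hd_drop_conv_nth)
  ultimately show ?thesis using x by (simp add: adj_cycle_def)
qed

lemma own_path_first_nbr:
  assumes es: "path es" "set es \<subseteq> S" and own: "nbrs (last es) \<subseteq> set es" "nbrs (last es) \<noteq> {}"
  obtains x where "x < length es - 1" "adj (last es) (es ! x)"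
    "nbrs (last es) \<subseteq> (\<lambda>a. es ! a) ` {x..<length es - 1}"
proof -
  define x where "x = (LEAST x. x < length es \<and> adj (last es) (es ! x))"
  obtain y where "y \<in> nbrs (last es)" using own by auto
  then obtain a where "a < length es" "adj (last es) (es ! a)"
    using own by (auto simp: nbrs_def subset_eq in_set_conv_nth)
  then have x: "x < length es \<and> adj (last es) (es ! x)"
    using LeastI[of "\<lambda>x. x < length es \<and> adj (last es) (es ! x)" a] by (simp add: x_def)
  have ne_last: "a \<noteq> length es - 1" if "adj (last es) (es ! a)" for a
    using that es(1) adj_irrefl by (auto simp: adj_path_def last_conv_nth)
  then have "x < length es - 1" using x by force
  moreover have "nbrs (last es) \<subseteq> (\<lambda>a. es ! a) ` {x..<length es - 1}"
  proof
    fix y assume y: "y \<in> nbrs (last es)"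
    then obtain a where a: "a < length es" "y = es ! a" using own(1) by (metis in_set_conv_nth subsetD)
    have adj: "adj (last es) (es ! a)" using y a by (simp add: nbrs_def)
    have "x \<le> a" using a adj Least_le[of "\<lambda>x. x < length es \<and> adj (last es) (es ! x)" a] by (simp add: x_def)
    moreover have "a < length es - 1" using ne_last[OF adj] a by simp
    ultimately show "y \<in> (\<lambda>a. es ! a) ` {x..<length es - 1}" using a by auto
  qed
  ultimately show ?thesis using that x by blast
qed

text \<open>The cycle from the first neighbour of the end onwards contains the end besides all its
  neighbours, and has at most \<open>length Q\<close> vertices.\<close>

lemma own_path_degree_less:
  assumes es: "path es" "set es \<subseteq> S" and own: "nbrs (last es) \<subseteq> set es"
  shows "card (nbrs (last es)) < length Q"
proof (cases "nbrs (last es) = {}")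
  case True
  then show ?thesis using Q_cycle by simp
next
  case False
  from own_path_first_nbr[OF es own False] obtain x where x: "x < length es - 1" "adj (last es) (es ! x)"
    and sub: "nbrs (last es) \<subseteq> (\<lambda>a. es ! a) ` {x..<length es - 1}" .
  have "card (nbrs (last es)) \<le> card {x..<length es - 1}"
    using sub by (meson card_image_le card_mono finite_atLeastLessThan finite_imageI le_trans)
  moreover have "set (drop x es) \<subseteq> S" using set_drop_subset es(2) by fastforce
  then have "length (drop x es) \<le> length Q"
    using own_path_cycle[OF es x] by (intro cycle_length_le) auto
  ultimately show ?thesis using x by simp
qed

text \<open>A nontrivial path contains an edge, and an edge counts as a cycle of length 2.\<close>

lemma two_le_length_Q:
  assumes "linkage E" "i < length Q" "2 \<le> length (E i)"
  shows "2 \<le> length Q"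
proof -
  obtain u v xs where uv: "E i = u # v # xs" using assms(3) by (cases "E i"; cases "tl (E i)") auto
  have "cyc [u, v]" using linkage_path(1)[OF assms(1,2)] adj_sym
    by (auto simp: uv adj_path_def adj_cycle_def)
  moreover have "set [u, v] \<subseteq> S" using linkage_path(3)[OF assms(1,2)] uv by auto
  ultimately show ?thesis using cycle_length_le by fastforce
qed

lemma linkage_take:
  assumes "linkage E" "k < length Q" "d < length (E k)"
  shows "path (take (Suc d) (E k))" "hd (take (Suc d) (E k)) = Q ! k" "last (take (Suc d) (E k)) = E k ! d"
    "set (take (Suc d) (E k)) \<subseteq> set (E k)" "Q ! k \<in> set (take (Suc d) (E k))"
    "length (take (Suc d) (E k)) = Suc d"
proof -
  let ?T = "take (Suc d) (E k)"
  note p = linkage_path[OF assms(1,2)]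
  show "path ?T" using p(1) by (rule path_take) simp
  show hd: "hd ?T = Q ! k" using p(2,5) by (simp add: hd_take)
  show "last ?T = E k ! d" using assms(3) by (simp add: take_Suc_conv_app_nth)
  show "set ?T \<subseteq> set (E k)" by (rule set_take_subset)
  have "?T \<noteq> []" using p(5) by simp
  then show "Q ! k \<in> set ?T" using hd by (metis hd_in_set)
  show "length ?T = Suc d" using assms(3) by simp
qed

text \<open>Each other path carrying a neighbour of the end \<open>w\<close> gives ears of
  \<open>Q\<close> through \<open>w\<close>: one to the root \<open>Q ! i\<close> and one to the
  root of any further such path. The resulting distances on \<open>Q\<close> leave room for two
  units per neighbour of \<open>w\<close>.\<close>

lemma degree_le_half:
  assumes E: "maximal E" and i: "i < length Q" and len: "2 \<le> length (E i)"
    and ext: "\<not> nbrs (last (E i)) \<subseteq> set (E i)"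
  shows "2 * card (nbrs (last (E i))) \<le> length Q"
proof -
  note l = maximal_linkage[OF E]
  define w where "w = last (E i)"
  \<comment> \<open>The other paths that carry a neighbour of \<open>w\<close>; \<open>d k\<close>
    is the position of the last one on \<open>E k\<close>, which makes the ears as long as
    possible.\<close>
  define K where "K = {k. k < length Q \<and> k \<noteq> i \<and> (\<exists>a<length (E k). adj w (E k ! a))}"
  define d where "d k = Max {a. a < length (E k) \<and> adj w (E k ! a)}" for k
  have d: "d k < length (E k)" "adj w (E k ! d k)" if "k \<in> K" for k
  proof -
    have "d k \<in> {a. a < length (E k) \<and> adj w (E k ! a)}"
      unfolding d_def using that by (intro Max_in) (auto simp: K_def)
    then show "d k < length (E k)" "adj w (E k ! d k)" by auto
  qed
  have d_max: "a \<le> d k" if "a < length (E k)" "adj w (E k ! a)" for k a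
    unfolding d_def using that by (intro Max_ge) auto
  note p = linkage_path[OF l i]
  have wE: "w \<in> set (E i)" using p by (simp add: w_def)
  have nb: "\<exists>k<length Q. \<exists>a<length (E k). y = E k ! a \<and> adj w (E k ! a)" if "y \<in> nbrs w" for y
    using maximal_end_nbr[OF E i, folded w_def, OF that] that
    by (metis (mono_tags, lifting) in_set_conv_nth mem_Collect_eq nbrs_def)
  have fK: "finite K" unfolding K_def by simp
  have "K \<noteq> {}"
  proof -
    obtain y where y: "y \<in> nbrs w" "y \<notin> set (E i)" using ext by (auto simp: w_def)
    with nb[OF y(1)] show ?thesis by (fastforce simp: K_def)
  qed
  have wQ: "w \<notin> set Q"
    using linkage_nth_notin_Q[OF l i, of "length (E i) - 1"] len p by (simp add: w_def last_conv_nth)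
  \<comment> \<open>\<open>f k\<close> is twice a bound on the number of neighbours of
    \<open>w\<close> on \<open>E k\<close>, and \<open>(f k + f k') / 2\<close> is the number of
    edges of the ear between the roots of \<open>E k\<close> and \<open>E k'\<close>.\<close>
  define f where "f k = (if k = i then 2 * (length (E i) - 1) else 2 + 2 * d k)" for k
  have ear_i: "length (E i) + d k \<le> gap i k \<and> length (E i) + d k + gap i k \<le> length Q"
    if "k \<in> K" for k
  proof -
    have k: "k < length Q" "k \<noteq> i" using that by (auto simp: K_def)
    note t = linkage_take[OF l k(1) d(1)[OF that]]
    let ?T = "take (Suc (d k)) (E k)"
    have dis: "set (E i) \<inter> set (E k) = {}" using linkage_disjoint[OF l i k(1)] k(2) by simp
    have "path (E i @ rev ?T)"
      using p t dis d(2)[OF that] by (intro path_append path_rev) (auto simp: hd_rev w_def)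
    moreover have "set (E i @ rev ?T) \<inter> set Q = {Q ! i, Q ! k}"
      using linkage_Int_Q[OF l i] linkage_Int_Q[OF l k(1)] t(4,5) by auto
    moreover have "last (E i @ rev ?T) = Q ! k" using t by (auto simp: last_rev last_append adj_path_def)
    moreover have "set (E i @ rev ?T) \<subseteq> S" using p t linkage_path(3)[OF l k(1)] by auto
    ultimately have "length (E i @ rev ?T) \<le> gap i k + 1 \<and> length (E i @ rev ?T) + gap i k \<le> length Q + 1"
      using p k i len t(6) by (intro longest_ear_path[OF longest_Q]) auto
    then show ?thesis using t(6) by simp
  qed
  have ear_K: "2 + d k + d k' \<le> gap k k' \<and> 2 + d k + d k' + gap k k' \<le> length Q"
    if kk: "k \<in> K" "k' \<in> K" "k \<noteq> k'" for k k'
  proof -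
    have k: "k < length Q" "k \<noteq> i" "k' < length Q" "k' \<noteq> i" using kk by (auto simp: K_def)
    note t = linkage_take[OF l k(1) d(1)[OF kk(1)]] and t' = linkage_take[OF l k(3) d(1)[OF kk(2)]]
    let ?T = "take (Suc (d k)) (E k)" and ?T' = "take (Suc (d k')) (E k')"
    have dis: "set (E k) \<inter> set (E k') = {}" "w \<notin> set (E k)" "w \<notin> set (E k')"
      using linkage_disjoint[OF l k(1,3) kk(3)] linkage_disjoint[OF l i k(1)]
        linkage_disjoint[OF l i k(3)] k wE by auto
    have ww: "path [w]" by (simp add: adj_path_def)
    have "path ([w] @ rev ?T')"
      using t' dis d(2)[OF kk(2)] ww by (intro path_append path_rev) (auto simp: hd_rev)
    then have "path (?T @ [w] @ rev ?T')"
      using t t' dis d(2)[OF kk(1)] adj_sym by (intro path_append[of ?T]) auto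
    moreover have "set (?T @ [w] @ rev ?T') \<inter> set Q = {Q ! k, Q ! k'}"
      using linkage_Int_Q[OF l k(1)] linkage_Int_Q[OF l k(3)] t(4,5) t'(4,5) wQ by auto
    moreover have "last (?T @ [w] @ rev ?T') = Q ! k'" "hd (?T @ [w] @ rev ?T') = Q ! k"
      using t t' by (auto simp: last_rev hd_append adj_path_def)
    moreover have "set (?T @ [w] @ rev ?T') \<subseteq> S"
      using p t t' wE linkage_path(3)[OF l k(1)] linkage_path(3)[OF l k(3)] by auto
    ultimately have "length (?T @ [w] @ rev ?T') \<le> gap k k' + 1 \<and>
        length (?T @ [w] @ rev ?T') + gap k k' \<le> length Q + 1"
      using k kk t(6) t'(6) by (intro longest_ear_path[OF longest_Q]) auto
    then show ?thesis using t(6) t'(6) by simp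
  qed
  have "sum f (insert i K) \<le> length Q"
  proof (rule sum_le_cycle_length)
    show "insert i K \<subseteq> {..<length Q}" using i by (auto simp: K_def)
    show "f p + f q \<le> 2 * gap p q \<and> f p + f q + 2 * gap p q \<le> 2 * length Q"
      if "p \<in> insert i K" "q \<in> insert i K" "p \<noteq> q" for p q
    proof -
      consider "p = i" "q \<in> K" "q \<noteq> i" | "q = i" "p \<in> K" "p \<noteq> i" | "p \<in> K" "q \<in> K" "p \<noteq> i" "q \<noteq> i"
        using \<open>p \<in> insert i K\<close> \<open>q \<in> insert i K\<close> \<open>p \<noteq> q\<close> by auto
      then show ?thesis
      proof cases
        case 1
        then show ?thesis using ear_i[of q] len by (auto simp: f_def)
      next
        case 2
        then show ?thesis using ear_i[of p] len gap_commute[of i p] by (auto simp: f_def)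
      next
        case 3
        then show ?thesis using ear_K[of p q] \<open>p \<noteq> q\<close> by (auto simp: f_def)
      qed
    qed
    \<comment> \<open>This case does not occur, because \<open>ext\<close> puts some index other
      than \<open>i\<close> into \<open>K\<close>.\<close>
    show "f p \<le> length Q" if "insert i K = {p}" for p
    proof -
      have "i \<notin> K" by (auto simp: K_def)
      with that \<open>K \<noteq> {}\<close> show ?thesis by auto
    qed
  qed
  moreover have "i \<notin> K" by (auto simp: K_def)
  moreover from this have "sum f K = (\<Sum>k\<in>K. 2 + 2 * d k)" by (intro sum.cong) (auto simp: f_def)
  ultimately have sum: "2 * (length (E i) - 1) + (\<Sum>k\<in>K. 2 + 2 * d k) \<le> length Q"
    using fK by (simp add: f_def)
  have "nbrs w \<subseteq> (set (E i) - {w}) \<union> (\<Union>k\<in>K. (\<lambda>a. E k ! a) ` {..d k})"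
  proof
    fix y assume y: "y \<in> nbrs w"
    from nb[OF y] obtain k a where ka: "k < length Q" "a < length (E k)" "y = E k ! a" "adj w (E k ! a)"
      by auto
    show "y \<in> (set (E i) - {w}) \<union> (\<Union>k\<in>K. (\<lambda>a. E k ! a) ` {..d k})"
    proof (cases "k = i")
      case True
      then show ?thesis using ka adj_irrefl by auto
    next
      case False
      then have "k \<in> K" "a \<le> d k" using ka d_max by (auto simp: K_def)
      then show ?thesis using ka by auto
    qed
  qed
  then have "card (nbrs w) \<le> card ((set (E i) - {w}) \<union> (\<Union>k\<in>K. (\<lambda>a. E k ! a) ` {..d k}))"
    using fK by (intro card_mono) auto
  also have "\<dots> \<le> card (set (E i) - {w}) + card (\<Union>k\<in>K. (\<lambda>a. E k ! a) ` {..d k})"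
    by (rule card_Un_le)
  also have "card (set (E i) - {w}) = length (E i) - 1"
    using wE p(1) by (simp add: adj_path_def distinct_card card_Diff_singleton_if)
  also have "card (\<Union>k\<in>K. (\<lambda>a. E k ! a) ` {..d k}) \<le> (\<Sum>k\<in>K. card ((\<lambda>a. E k ! a) ` {..d k}))"
    using fK by (rule card_UN_le)
  also have "\<dots> \<le> (\<Sum>k\<in>K. Suc (d k))"
    by (rule sum_mono) (metis card_atMost card_image_le finite_atMost)
  finally have "card (nbrs w) \<le> length (E i) - 1 + (\<Sum>k\<in>K. Suc (d k))" by simp
  moreover have "(\<Sum>k\<in>K. 2 + 2 * d k) = 2 * (\<Sum>k\<in>K. Suc (d k))"
    by (simp add: sum_distrib_left)
  ultimately have "2 * card (nbrs w) \<le> 2 * (length (E i) - 1) + (\<Sum>k\<in>K. 2 + 2 * d k)"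
    by linarith
  with sum show ?thesis by (simp add: w_def)
qed

lemma degree_less:
  assumes E: "maximal E" and i: "i < length Q" and len: "2 \<le> length (E i)"
  shows "card (nbrs (last (E i))) < length Q"
proof (cases "nbrs (last (E i)) \<subseteq> set (E i)")
  case True
  then show ?thesis
    using own_path_degree_less linkage_path[OF maximal_linkage[OF E] i] by blast
next
  case False
  then show ?thesis
    using degree_le_half[OF E i len] two_le_length_Q[OF maximal_linkage[OF E] i len] by simp
qed

text \<open>Two neighbours of a vertex off \<open>Q\<close> are joined by an ear with one inner
  vertex, so they are at distance at least 2 along both arcs of \<open>Q\<close>. Weight 2 per
  neighbour then fits on the cycle, unless there is only one.\<close>

lemma nbrs_on_cycle:
  assumes z: "z \<in> S" "z \<notin> set Q" and I: "\<And>p. p \<in> I \<Longrightarrow> p < length Q \<and> adj z (Q ! p)"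
  shows "card I \<le> 1 \<or> 2 * card I \<le> length Q"
proof (cases "\<exists>p. I = {p}")
  case False
  have "sum (\<lambda>_. 2) I \<le> length Q"
  proof (rule sum_le_cycle_length)
    show "2 + 2 \<le> 2 * gap p q \<and> 2 + 2 + 2 * gap p q \<le> 2 * length Q"
      if "p \<in> I" "q \<in> I" "p \<noteq> q" for p q
    proof -
      have "length [z] < gap p q \<and> length [z] + gap p q < length Q"
        using that I z adj_sym by (intro longest_ear[OF longest_Q]) (auto simp: adj_path_def)
      then show ?thesis by simp
    qed
  qed (use I False in auto)
  then show ?thesis by simp
qed auto

subsection \<open>Rotations and the choice of the vertices \<open>w\<^sub>i\<close>\<close>

lemma degree_le_length:
  assumes es: "path es" and own: "nbrs (last es) \<subseteq> set es"
  shows "card (nbrs (last es)) < length es"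
proof -
  have l: "last es \<in> set es" using es by (simp add: adj_path_def)
  have "nbrs (last es) \<subseteq> set es - {last es}" using own adj_irrefl by (auto simp: nbrs_def)
  then have "card (nbrs (last es)) \<le> card (set es - {last es})" by (intro card_mono) auto
  also have "\<dots> < card (set es)" using l by (intro card_Diff1_less) auto
  also have "\<dots> = length es" using es by (simp add: adj_path_def distinct_card)
  finally show ?thesis .
qed

text \<open>A Posa rotation: the edge from the end to \<open>es ! (t - 1)\<close> replaces the edge
  between \<open>es ! (t - 1)\<close> and \<open>es ! t\<close>, which makes \<open>es ! t\<close>
  the new end.\<close>

lemma rotation_path:
  assumes es: "path es" and t: "0 < t" "t < length es" "adj (last es) (es ! (t - 1))"
  shows "path (take t es @ rev (drop t es))"
proof (rule path_append)
  show "path (take t es)" "path (rev (drop t es))"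
    using es t by (auto intro: path_take path_rev path_drop)
  show "set (take t es) \<inter> set (rev (drop t es)) = {}"
    using es set_take_disj_set_drop_if_distinct[of es t t] by (simp add: adj_path_def)
  have "last (take t es) = es ! (t - 1)" using t by (cases t) (auto simp: take_Suc_conv_app_nth)
  then show "adj (last (take t es)) (hd (rev (drop t es)))"
    using t adj_sym by (simp add: hd_rev)
qed

text \<open>The ends of all rotations of a path whose last vertex has more than half as many neighbours as
  \<open>Q\<close> has vertices lie on one cycle. There are enough of them to assign distinct ones to all vertices
  of \<open>Q\<close> adjacent to the second vertex of the path.\<close>

lemma big_group:
  assumes E: "maximal E" and j: "j < length Q" and len: "2 \<le> length (E j)"
    and big: "length Q < 2 * card (nbrs (last (E j)))"
    and A: "\<And>p. p \<in> A \<Longrightarrow> p < length Q \<and> adj (E j ! 1) (Q ! p)"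
  obtains v where
    "\<And>i. i \<in> A \<Longrightarrow> v i \<in> S \<and> card (nbrs (v i)) < length Q \<and>
       (\<exists>F. path F \<and> hd F = Q ! i \<and> last F = v i \<and> set F \<subseteq> insert (Q ! i) (set (E j) - {Q ! j}) \<and>
            length F = length (E j))"
    and "\<And>M N. M \<subseteq> A \<Longrightarrow> N \<subseteq> A \<Longrightarrow> M \<noteq> {} \<Longrightarrow> N \<noteq> {} \<Longrightarrow>
       \<exists>i\<in>M. \<exists>k\<in>N. \<exists>zs. path zs \<and> hd zs = v i \<and> last zs = v k \<and> set zs \<subseteq> S \<and>
         card M + card N \<le> 2 * length zs"
proof -
  note l = maximal_linkage[OF E]
  define es where "es = E j"
  define w where "w = last es"
  have es: "path es" "set es \<subseteq> S" "hd es = Q ! j" "2 \<le> length es"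
    using linkage_path[OF l j] len by (auto simp: es_def)
  have dist: "distinct es" using es by (simp add: adj_path_def)
  have own: "nbrs w \<subseteq> set es"
    using degree_le_half[OF E j len] big by (force simp: w_def es_def)
  have ne: "nbrs w \<noteq> {}" using big by (auto simp: w_def es_def)
  from own_path_first_nbr[OF es(1,2) own[unfolded w_def] ne[unfolded w_def]]
  obtain x where x: "x < length es - 1" "adj w (es ! x)"
    and sub: "nbrs w \<subseteq> (\<lambda>a. es ! a) ` {x..<length es - 1}" unfolding w_def .
  define D where "D = drop x es"
  have D: "cyc D" using own_path_cycle[OF es(1,2) x[unfolded w_def]] by (simp add: D_def)
  \<comment> \<open>Positions whose vertices become ends by one rotation. \<open>2 \<le> t\<close>
    keeps the first two vertices of the path in place, and \<open>x < t\<close> puts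
    \<open>es ! t\<close> on the cycle \<open>D\<close>.\<close>
  define T where "T = {t. 2 \<le> t \<and> x < t \<and> t < length es \<and> adj w (es ! (t - 1))}"
  have fT: "finite T" unfolding T_def by simp
  \<comment> \<open>Only a neighbour at position 0 is not accounted for by \<open>T\<close>, so
    \<open>card T\<close> is at least the degree of \<open>w\<close> minus 1.\<close>
  have "nbrs w \<subseteq> insert (es ! 0) ((\<lambda>t. es ! (t - 1)) ` T)"
  proof
    fix y assume y: "y \<in> nbrs w"
    then obtain a where a: "x \<le> a" "a < length es - 1" "y = es ! a" using subsetD[OF sub y] by auto
    show "y \<in> insert (es ! 0) ((\<lambda>t. es ! (t - 1)) ` T)"
    proof (cases "a = 0")
      case False
      then have "Suc a \<in> T" using a y by (auto simp: T_def nbrs_def)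
      then show ?thesis using a by force
    qed (use a in simp)
  qed
  then have "card (nbrs w) \<le> card (insert (es ! 0) ((\<lambda>t. es ! (t - 1)) ` T))"
    using fT by (intro card_mono) auto
  also have "\<dots> \<le> Suc (card T)"
    using card_image_le[OF fT, of "\<lambda>t. es ! (t - 1)"] by (simp add: card_insert_if fT)
  finally have card_T: "length Q < 2 * Suc (card T)" using big by (simp add: w_def es_def)
  have c2: "2 \<le> length Q" using two_le_length_Q[OF l j len] .
  have z: "es ! 1 \<in> S" "es ! 1 \<notin> set Q"
    using es linkage_nth_notin_Q[OF l j, of 1] len by (auto simp: es_def)
  \<comment> \<open>The second vertex of the path lies off \<open>Q\<close>, so it is adjacent to at
    most half of \<open>Q\<close> or to a single vertex; either way \<open>T\<close> is large
    enough.\<close>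
  have "card A \<le> 1 \<or> 2 * card A \<le> length Q"
    using A by (intro nbrs_on_cycle[OF z]) (auto simp: es_def)
  then have card_A: "card A \<le> card T" using card_T c2 by auto
  have "finite A" using A finite_subset[of A "{..<length Q}"] by auto
  then obtain \<tau> where \<tau>: "\<tau> ` A \<subseteq> T" "inj_on \<tau> A" using card_le_inj[OF _ fT card_A] by auto
  obtain y ys where ys: "es = Q ! j # y # ys" using es by (cases es; cases "tl es") auto
  have rot: "\<exists>G. path (Q ! j # y # G) \<and> set (Q ! j # y # G) = set es \<and>
      length (Q ! j # y # G) = length es \<and> last (Q ! j # y # G) = es ! t" if "t \<in> T" for t
  proof -
    have t: "2 \<le> t" "t < length es" "adj w (es ! (t - 1))" using that by (auto simp: T_def)
    define F where "F = take t es @ rev (drop t es)"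
    have F: "path F" using rotation_path[OF es(1)] t by (simp add: F_def w_def)
    have sF: "set F = set es"
      by (metis F_def append_take_drop_id set_append set_rev)
    have lF: "length F = length es" using t by (simp add: F_def)
    have eF: "last F = es ! t" using t by (simp add: F_def last_rev hd_drop_conv_nth)
    obtain a where "t = Suc (Suc a)" using t(1) by (auto simp: numeral_2_eq_2 dest: Suc_le_D)
    then have "F = Q ! j # y # (take a ys @ rev (drop a ys))" by (simp add: F_def ys)
    with F sF lF eF show ?thesis by (intro exI[of _ "take a ys @ rev (drop a ys)"]) simp
  qed
  \<comment> \<open>A rotated path has the same root and vertices, so exchanging it for
    \<open>E j\<close> preserves maximality, and \<open>degree_less\<close> applies to its
    end.\<close>
  have deg: "card (nbrs (es ! t)) < length Q" if "t \<in> T" for t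
  proof -
    from rot[OF that] obtain G where "path (Q ! j # y # G)" "set (Q ! j # y # G) = set es"
      "length (Q ! j # y # G) = length es" "last (Q ! j # y # G) = es ! t" by blast
    moreover define F where "F = Q ! j # y # G"
    ultimately have F: "path F" and sF: "set F = set es" and hF: "hd F = Q ! j"
      and lF: "length F = length es" and eF: "last F = es ! t"
      by simp_all
    have lk: "linkage (E(j := F))"
      using F hF sF es linkage_disjoint[OF l j] by (intro linkageI_upd[OF l j]) (auto simp: es_def)
    moreover have "weight (E(j := F)) = weight E"
      using weight_upd[OF j, of E F] lF by (simp add: wt_def es_def split: if_splits)
    ultimately have "maximal (E(j := F))" using E by (simp add: maximal_def)
    from degree_less[OF this j] show ?thesis using lF eF len by (simp add: es_def)
  qed
  define v where "v i = es ! \<tau> i" for i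
  show ?thesis
  proof (rule that[of v])
    fix i assume i: "i \<in> A"
    then have \<tau>T: "\<tau> i \<in> T" using \<tau> by auto
    from rot[OF this] obtain G where F: "path (Q ! j # y # G)" and sF: "set (Q ! j # y # G) = set es"
      and lF: "length (Q ! j # y # G) = length es" and eF: "last (Q ! j # y # G) = v i"
      unfolding v_def by blast
    \<comment> \<open>The rotated path still begins with \<open>Q ! j\<close> and \<open>y\<close>,
      and \<open>Q ! i\<close> is adjacent to \<open>y\<close>; so \<open>Q ! i\<close> can take the
      place of \<open>Q ! j\<close>.\<close>
    have QiF: "Q ! i \<notin> set (y # G)"
    proof
      assume Qi: "Q ! i \<in> set (y # G)"
      then have "Q ! i \<in> set (E j)" using sF by (auto simp: es_def)
      moreover have "Q ! i \<in> set Q" using A[OF i] by simp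
      ultimately have "Q ! i = Q ! j" using linkage_Int_Q[OF l j] by blast
      then show False using Qi F by (auto simp: adj_path_def)
    qed
    have "adj (Q ! i) y" using A[OF i] adj_sym ys by (auto simp: es_def)
    then have "path (Q ! i # y # G)"
      using F QiF by (auto simp: adj_path_def)
    moreover have "set (Q ! i # y # G) \<subseteq> insert (Q ! i) (set (E j) - {Q ! j})"
    proof -
      have "Q ! j \<notin> set (y # G)" using F by (auto simp: adj_path_def)
      then show ?thesis using sF by (auto simp: es_def)
    qed
    moreover have "last (Q ! i # y # G) = v i" using eF by simp
    moreover have "length (Q ! i # y # G) = length (E j)" using lF by (simp add: es_def)
    ultimately have "\<exists>F. path F \<and> hd F = Q ! i \<and> last F = v i \<and>
      set F \<subseteq> insert (Q ! i) (set (E j) - {Q ! j}) \<and> length F = length (E j)"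
      by (intro exI[of _ "Q ! i # y # G"]) auto
    moreover have "v i \<in> S" using \<tau>T es(2) by (auto simp: v_def T_def)
    ultimately show "v i \<in> S \<and> card (nbrs (v i)) < length Q \<and>
       (\<exists>F. path F \<and> hd F = Q ! i \<and> last F = v i \<and> set F \<subseteq> insert (Q ! i) (set (E j) - {Q ! j}) \<and>
            length F = length (E j))"
      using deg[OF \<tau>T] by (simp add: v_def)
  next
    fix M N assume MN: "M \<subseteq> A" "N \<subseteq> A" "M \<noteq> {}" "N \<noteq> {}"
    \<comment> \<open>Positions on the cycle \<open>D\<close>. They differ for distinct indices,
      which reduces the claim to \<open>exists_far_pair\<close>.\<close>
    define \<sigma> where "\<sigma> i = \<tau> i - x" for i
    have \<tau>_T: "\<tau> i \<in> T" if "i \<in> A" for i using \<tau> that by auto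
    have T_gt: "x < t" "t < length es" if "t \<in> T" for t using that by (auto simp: T_def)
    have \<sigma>_lt: "\<sigma> i < length D" "D ! \<sigma> i = v i" if "i \<in> A" for i
      using T_gt[OF \<tau>_T[OF that]] by (auto simp: \<sigma>_def D_def v_def)
    have inj: "inj_on \<sigma> A"
    proof (rule inj_onI)
      fix a b assume ab: "a \<in> A" "b \<in> A" "\<sigma> a = \<sigma> b"
      then have "\<tau> a = \<tau> b" using T_gt(1)[OF \<tau>_T[OF ab(1)]] T_gt(1)[OF \<tau>_T[OF ab(2)]]
        by (simp add: \<sigma>_def)
      then show "a = b" using \<tau>(2) ab by (auto dest: inj_onD)
    qed
    show "\<exists>i\<in>M. \<exists>k\<in>N. \<exists>zs. path zs \<and> hd zs = v i \<and> last zs = v k \<and> set zs \<subseteq> S \<and>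
         card M + card N \<le> 2 * length zs"
    proof (cases "\<exists>i. M = {i} \<and> N = {i}")
      case True
      then obtain i where "M = {i}" "N = {i}" by auto
      moreover have "v i \<in> S" using T_gt(2)[OF \<tau>_T, of i] MN(1) es(2) \<open>M = {i}\<close> nth_mem[of "\<tau> i" es]
        by (auto simp: v_def)
      ultimately show ?thesis by (auto intro!: exI[of _ "[v i]"] simp: adj_path_def)
    next
      case False
      have "\<not> (\<exists>i. \<sigma> ` M = {i} \<and> \<sigma> ` N = {i})"
      proof
        assume "\<exists>i. \<sigma> ` M = {i} \<and> \<sigma> ` N = {i}"
        then obtain i where eq: "\<sigma> ` M = {i}" "\<sigma> ` N = {i}" by auto
        obtain a where a: "a \<in> M" using MN by auto
        have "b = a" if "b \<in> M \<union> N" for b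
        proof -
          have "\<sigma> b \<in> \<sigma> ` M \<union> \<sigma> ` N" "\<sigma> a \<in> \<sigma> ` M" using that a by blast+
          then have "\<sigma> b = \<sigma> a" unfolding eq by simp
          moreover have "b \<in> A" "a \<in> A" using that a MN by auto
          ultimately show ?thesis using inj by (auto dest: inj_onD)
        qed
        then have "M = {a}" "N = {a}" using MN by auto
        then show False using False by auto
      qed
      moreover have "\<sigma> ` M \<subseteq> {..<length D}" "\<sigma> ` N \<subseteq> {..<length D}" using \<sigma>_lt MN by auto
      moreover have "card (\<sigma> ` M) = card M" "card (\<sigma> ` N) = card N"
        using inj MN by (auto intro: card_image inj_on_subset)
      ultimately obtain i k where ik: "i \<in> M" "k \<in> N" "\<sigma> i \<noteq> \<sigma> k"
        "card M + card N \<le> 2 * (max (gap (\<sigma> i) (\<sigma> k)) (length D - gap (\<sigma> i) (\<sigma> k)) + 1)"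
        using exists_far_pair[of "\<sigma> ` M" "length D" "\<sigma> ` N"] MN by auto
      have ikA: "i \<in> A" "k \<in> A" using ik MN by auto
      obtain zs where zs: "path zs" "hd zs = D ! \<sigma> i" "last zs = D ! \<sigma> k" "set zs \<subseteq> set D"
        "length zs = Suc (max (gap (\<sigma> i) (\<sigma> k)) (length D - gap (\<sigma> i) (\<sigma> k)))"
        by (rule cycle_arc[OF D \<sigma>_lt(1)[OF ikA(1)] \<sigma>_lt(1)[OF ikA(2)] ik(3),
              of "max (gap (\<sigma> i) (\<sigma> k)) (length D - gap (\<sigma> i) (\<sigma> k))"]) (auto simp: max_def)
      have "set D \<subseteq> S" using set_drop_subset es(2) by (fastforce simp: D_def)
      then show ?thesis
        using zs ik \<sigma>_lt(2)[OF ikA(1)] \<sigma>_lt(2)[OF ikA(2)]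
        by (intro bexI[of _ i] bexI[of _ k] exI[of _ zs]) auto
    qed
  qed
qed

text \<open>The indices are grouped by \<open>root\<close>. Within the group of a path whose end has
  high degree, \<open>big_group\<close> supplies the vertices and the long paths; indices with
  different roots are connected along the longer arc of \<open>Q\<close>.\<close>

lemma exists_spread_vertices:
  obtains w :: "nat \<Rightarrow> 'a" where
    "\<And>i. i < length Q \<Longrightarrow> w i \<in> S"
    "(\<Sum>i<length Q. card (nbrs (w i))) \<le> length Q * (length Q - 1)"
    "\<And>M N. M \<subseteq> {..<length Q} \<Longrightarrow> N \<subseteq> {..<length Q} \<Longrightarrow> M \<noteq> {} \<Longrightarrow> N \<noteq> {} \<Longrightarrow>
       \<exists>i\<in>M. \<exists>k\<in>N. \<exists>zs. path zs \<and> hd zs = w i \<and> last zs = w k \<and> set zs \<subseteq> S \<and>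
         card M + card N \<le> 2 * length zs"
proof -
  obtain E where E: "maximal E" using exists_maximal by auto
  note l = maximal_linkage[OF E]

  \<comment> \<open>Grouping the indices\<close>
  define c where "c = length Q"
  define big where "big j \<longleftrightarrow> j < c \<and> 2 \<le> length (E j) \<and> c < 2 * card (nbrs (last (E j)))" for j
  \<comment> \<open>An index with a trivial path joins some big path whose second vertex is adjacent
    to it, chosen arbitrarily; every other index is its own root.\<close>
  define root where "root i = (if length (E i) = 1 \<and> (\<exists>j. big j \<and> adj (E j ! 1) (Q ! i))
    then SOME j. big j \<and> adj (E j ! 1) (Q ! i) else i)" for i
  have root_triv: "big (root i) \<and> adj (E (root i) ! 1) (Q ! i)"
    if "length (E i) = 1" "\<exists>j. big j \<and> adj (E j ! 1) (Q ! i)" for i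
    using someI_ex[OF that(2)] that by (simp add: root_def)
  have root_cases: "root i = i \<or> length (E i) = 1 \<and> big (root i) \<and> adj (E (root i) ! 1) (Q ! i)" for i
  proof (cases "length (E i) = 1 \<and> (\<exists>j. big j \<and> adj (E j ! 1) (Q ! i))")
    case True
    then show ?thesis using root_triv[of i] by blast
  next
    case False
    then show ?thesis unfolding root_def by (simp only: if_False) simp
  qed
  have adj_root: "adj (E j ! 1) (Q ! j)" if j: "j < c" "2 \<le> length (E j)" for j
  proof -
    obtain y ys where "E j = Q ! j # y # ys"
      using j linkage_path(2)[OF l, of j] by (cases "E j"; cases "tl (E j)") (auto simp: c_def)
    then show ?thesis using j linkage_path(1)[OF l, of j] adj_sym by (auto simp: c_def adj_path_def)
  qed
  have root_lt: "root i < c" if "i < c" for i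
    using root_cases[of i] that by (auto simp: big_def)
  have root_big: "adj (E (root i) ! 1) (Q ! i)" if "i < c" "big (root i)" for i
    using root_cases[of i] adj_root[of i] that by (auto simp: big_def)
  have root_low: "root i = i" if "\<not> big (root i)" for i
    using root_cases[of i] that by blast
  define A where "A j = {i. i < c \<and> root i = j}" for j
  define good where "good j v \<longleftrightarrow> (\<forall>i\<in>A j. v i \<in> S \<and> card (nbrs (v i)) < c \<and>
       (\<exists>F. path F \<and> hd F = Q ! i \<and> last F = v i \<and> set F \<subseteq> insert (Q ! i) (set (E j) - {Q ! j}) \<and>
            length F = length (E j))) \<and>
      (\<forall>M N. M \<subseteq> A j \<longrightarrow> N \<subseteq> A j \<longrightarrow> M \<noteq> {} \<longrightarrow> N \<noteq> {} \<longrightarrow>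
       (\<exists>i\<in>M. \<exists>k\<in>N. \<exists>zs. path zs \<and> hd zs = v i \<and> last zs = v k \<and> set zs \<subseteq> S \<and>
         card M + card N \<le> 2 * length zs))" for j v
  have "\<exists>v. good j v" if "big j" for j
  proof -
    have j: "j < length Q" "2 \<le> length (E j)" "length Q < 2 * card (nbrs (last (E j)))"
      using that by (auto simp: big_def c_def)
    have A: "p < length Q \<and> adj (E j ! 1) (Q ! p)" if "p \<in> A j" for p
      using that root_big[of p] \<open>big j\<close> by (auto simp: A_def c_def)
    show ?thesis
    proof (rule big_group[OF E j A])
      fix v
      assume 1: "\<And>i. i \<in> A j \<Longrightarrow> v i \<in> S \<and> card (nbrs (v i)) < length Q \<and>
          (\<exists>F. path F \<and> hd F = Q ! i \<and> last F = v i \<and> set F \<subseteq> insert (Q ! i) (set (E j) - {Q ! j}) \<and>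
            length F = length (E j))"
        and 2: "\<And>M N. M \<subseteq> A j \<Longrightarrow> N \<subseteq> A j \<Longrightarrow> M \<noteq> {} \<Longrightarrow> N \<noteq> {} \<Longrightarrow>
          \<exists>i\<in>M. \<exists>k\<in>N. \<exists>zs. path zs \<and> hd zs = v i \<and> last zs = v k \<and> set zs \<subseteq> S \<and>
            card M + card N \<le> 2 * length zs"
      have "good j v"
        unfolding good_def c_def
        by (intro conjI[OF ballI allI] allI impI) (erule 1, erule (3) 2)
      then show ?thesis by blast
    qed
  qed
  then obtain v where v: "\<And>j. big j \<Longrightarrow> good j (v j)" by metis
  define w where "w i = (if big (root i) then v (root i) i else last (E i))" for i

  \<comment> \<open>Paths between the chosen vertices\<close>
  have branch: "\<exists>F. path F \<and> hd F = Q ! i \<and> last F = w i \<and>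
      set F \<subseteq> insert (Q ! i) (set (E (root i)) - {Q ! root i}) \<and> length F = length (E (root i))"
    if "i < c" for i
  proof (cases "big (root i)")
    case True
    have "i \<in> A (root i)" using that by (simp add: A_def)
    with v[OF True] True show ?thesis unfolding good_def w_def by auto
  next
    case False
    then have r: "root i = i" by (rule root_low)
    have "w i = last (E i)" using False by (simp add: w_def)
    then show ?thesis
      using linkage_path(1,2)[OF l, of i] that unfolding r c_def by (intro exI[of _ "E i"]) auto
  qed
  \<comment> \<open>Apart from its start, the branch of \<open>i\<close> uses only vertices of
    \<open>E (root i)\<close> off \<open>Q\<close>. Branches with different roots are thus disjoint
    and can be joined along the longer arc of \<open>Q\<close>.\<close>
  have join: "\<exists>zs. path zs \<and> hd zs = w i \<and> last zs = w k \<and> set zs \<subseteq> S \<and>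
      length zs + 1 = length (E (root i)) + length (E (root k)) + max (gap i k) (c - gap i k)"
    if ik: "i < c" "k < c" and ne: "root i \<noteq> root k" for i k
  proof -
    obtain F where F: "path F" "hd F = Q ! i" "last F = w i"
      "set F \<subseteq> insert (Q ! i) (set (E (root i)) - {Q ! root i})" "length F = length (E (root i))"
      using branch[OF ik(1)] by blast
    obtain F' where F': "path F'" "hd F' = Q ! k" "last F' = w k"
      "set F' \<subseteq> insert (Q ! k) (set (E (root k)) - {Q ! root k})" "length F' = length (E (root k))"
      using branch[OF ik(2)] by blast
    have rl: "root i < length Q" "root k < length Q" "i < length Q" "k < length Q"
      using root_lt ik by (auto simp: c_def)
    have ik_ne: "i \<noteq> k" using ne by auto
    then have Qne: "Q ! i \<noteq> Q ! k" using rl Q_cycle(3) by (simp add: nth_eq_iff_index_eq)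
    have IQ: "set (E (root i)) \<inter> set Q = {Q ! root i}" "set (E (root k)) \<inter> set Q = {Q ! root k}"
      using linkage_Int_Q[OF l] rl by auto
    have mQ: "Q ! i \<in> set Q" "Q ! k \<in> set Q" using rl by auto
    have hF: "Q ! i \<in> set F" "Q ! k \<in> set F'"
      using F(1,2) F'(1,2) by (metis adj_path_def hd_in_set)+
    have dis: "set (E (root i)) \<inter> set (E (root k)) = {}" by (rule linkage_disjoint[OF l rl(1,2) ne])
    have l_ok: "max (gap i k) (c - gap i k) = gap i k \<or> max (gap i k) (c - gap i k) = length Q - gap i k"
      by (auto simp: max_def c_def)
    have "set F \<inter> set Q = {Q ! i}" using F(4) IQ(1) mQ hF by blast
    moreover have "set F' \<inter> set Q = {Q ! k}" using F'(4) IQ(2) mQ hF by blast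
    moreover have "set F \<inter> set F' = {}" using F(4) F'(4) IQ mQ Qne dis by blast
    ultimately obtain zs where zs: "path zs" "hd zs = last F" "last zs = last F'"
      "set zs \<subseteq> set F \<union> set F' \<union> set Q" "length zs + 1 = length F + length F' + max (gap i k) (c - gap i k)"
      using cycle_join[OF Q_cycle(1) rl(3,4) ik_ne F(1,2) _ F'(1,2) _ _ l_ok] by blast
    have "set F \<subseteq> S" "set F' \<subseteq> S"
      using F(4) F'(4) linkage_path(3)[OF l rl(1)] linkage_path(3)[OF l rl(2)] Q_cycle(2) mQ by blast+
    then have "set zs \<subseteq> S" using zs(4) Q_cycle(2) by blast
    then show ?thesis using zs F(3,5) F'(3,5) by auto
  qed
  have w_S: "w i \<in> S" if i: "i < c" for i
  proof -
    obtain F where F: "path F" "last F = w i"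
      "set F \<subseteq> insert (Q ! i) (set (E (root i)) - {Q ! root i})"
      using branch[OF i] by blast
    have "w i \<in> set F" using F(1,2) by (metis adj_path_def last_in_set)
    then have "w i = Q ! i \<or> w i \<in> set (E (root i))" using F(3) by auto
    moreover have "Q ! i \<in> S" using i Q_cycle(2) nth_mem[of i Q] by (auto simp: c_def)
    moreover have "set (E (root i)) \<subseteq> S"
      using linkage_path(3)[OF l, of "root i"] root_lt[OF i] by (simp add: c_def)
    ultimately show ?thesis by auto
  qed
  show ?thesis
  proof (rule that[of w])
    show "w i \<in> S" if "i < length Q" for i using w_S that by (simp add: c_def)
  next

    \<comment> \<open>Double counting for the degree sum\<close>
    define R where "R i k \<longleftrightarrow> i < c \<and> k < c \<and> length (E i) = 1 \<and> \<not> big (root i) \<and>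
      2 \<le> length (E k) \<and> adj (E k ! 1) (Q ! i)" for i k
    \<comment> \<open>A pair in \<open>R\<close> may raise the degree of \<open>w i\<close> by 1,
      which is counted by \<open>a i\<close>; it is charged to the path \<open>E k\<close>, where it
      is counted by \<open>b k\<close>.\<close>
    define a where "a i = (\<Sum>k<c. if R i k then 1 else 0 :: nat)" for i
    define b where "b k = (\<Sum>i<c. if R i k then 1 else 0 :: nat)" for k
    have ab: "sum a {..<c} = sum b {..<c}"
      unfolding a_def b_def by (rule sum.swap)
    have a_card: "a i = card {k. R i k}" for i
    proof -
      have "{..<c} \<inter> {k. R i k} = {k. R i k}" by (auto simp: R_def)
      then show ?thesis by (simp add: a_def sum.If_cases)
    qed
    have b_card: "b k = card {i. R i k}" for k
    proof -
      have "{..<c} \<inter> {i. R i k} = {i. R i k}" by (auto simp: R_def)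
      then show ?thesis by (simp add: b_def sum.If_cases)
    qed
    \<comment> \<open>An index with a trivial path adjacent to the second vertex of a big path has
      joined a big group.\<close>
    have R_low: "\<not> big k" if "R i k" for i k
      using root_triv[of i] that by (auto simp: R_def)
    \<comment> \<open>The sums of \<open>a\<close> and \<open>b\<close> agree, so they cancel when
      this estimate is summed over \<open>i\<close>.\<close>
    have "card (nbrs (w i)) + b i \<le> c - 1 + a i" if i: "i < c" for i
    proof -
      have "0 < length (E i)" using linkage_path(4)[OF l, of i] i by (simp add: c_def)
      then have "length (E i) = 1 \<or> 2 \<le> length (E i)" by linarith
      then consider "big (root i)" | "\<not> big (root i)" "length (E i) = 1" | "\<not> big (root i)" "2 \<le> length (E i)"
        by blast
      then show ?thesis
      proof cases
        case 1
        have "i \<in> A (root i)" using i by (simp add: A_def)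
        then have "card (nbrs (w i)) < c" using v[OF 1] 1 unfolding good_def w_def by auto
        moreover have "\<not> R k i" for k
        proof
          assume "R k i"
          then have "2 \<le> length (E i)" "\<not> big i" using R_low by (auto simp: R_def)
          then show False using 1 root_cases[of i] by auto
        qed
        then have "b i = 0" by (simp add: b_card)
        ultimately show ?thesis by simp
      next
        case 2
        have Ei: "E i = [Q ! i]" using 2 linkage_eq(1)[OF l, of i] i by (cases "E i") (auto simp: c_def)
        then have w: "w i = Q ! i" using 2 by (simp add: w_def)
        have "nbrs (Q ! i) \<subseteq> (set Q - {Q ! i}) \<union> (\<lambda>k. E k ! 1) ` {k. R i k}"
        proof
          fix y assume y: "y \<in> nbrs (Q ! i)"
          then have adj: "adj (Q ! i) y" by (simp add: nbrs_def)
          have "y \<in> set Q \<or> (\<exists>k<length Q. 1 < length (E k) \<and> y = E k ! 1)"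
            using maximal_trivial_nbr[OF E _ 2(2) y] i by (simp add: c_def)
          then show "y \<in> (set Q - {Q ! i}) \<union> (\<lambda>k. E k ! 1) ` {k. R i k}"
          proof
            assume "y \<in> set Q"
            then show ?thesis using adj adj_irrefl by auto
          next
            assume "\<exists>k<length Q. 1 < length (E k) \<and> y = E k ! 1"
            then obtain k where "k < c" "2 \<le> length (E k)" "y = E k ! 1" by (auto simp: c_def)
            moreover from this have "R i k" using 2 i adj adj_sym by (auto simp: R_def)
            ultimately show ?thesis by auto
          qed
        qed
        moreover have fR: "finite {k. R i k}" by (rule finite_subset[of _ "{..<c}"]) (auto simp: R_def)
        ultimately have "card (nbrs (Q ! i)) \<le> card ((set Q - {Q ! i}) \<union> (\<lambda>k. E k ! 1) ` {k. R i k})"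
          by (intro card_mono) auto
        also have "\<dots> \<le> card (set Q - {Q ! i}) + card ((\<lambda>k. E k ! 1) ` {k. R i k})" by (rule card_Un_le)
        also have "card (set Q - {Q ! i}) = c - 1"
          using i Q_cycle(3) by (simp add: c_def card_Diff_singleton_if distinct_card)
        also have "card ((\<lambda>k. E k ! 1) ` {k. R i k}) \<le> a i"
          using card_image_le[OF fR] by (simp add: a_card)
        finally have "card (nbrs (Q ! i)) \<le> c - 1 + a i" by simp
        moreover have "b i = 0" using 2 by (simp add: b_def R_def)
        ultimately show ?thesis by (simp add: w)
      next
        case 3
        then have "root i = i" by (intro root_low)
        then have nb: "\<not> big i" and w: "w i = last (E i)" using 3 by (auto simp: w_def)
        have c2: "2 \<le> c" using two_le_length_Q[OF l _ 3(2)] i by (simp add: c_def)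
        have D: "2 * card (nbrs (last (E i))) \<le> c" using nb 3 i by (simp add: big_def)
        have z: "E i ! 1 \<in> S" "E i ! 1 \<notin> set Q"
          using linkage_path(3)[OF l, of i] linkage_nth_notin_Q[OF l, of i 1] 3 i by (auto simp: c_def)
        \<comment> \<open>The root \<open>Q ! i\<close> is adjacent to the second vertex as well.
          Counting it too yields \<open>b i + 1 \<le> c / 2\<close> unless \<open>b i = 0\<close>,
          and the degree of the end is at most \<open>c / 2\<close>.\<close>
        have "card (insert i {k. R k i}) \<le> 1 \<or> 2 * card (insert i {k. R k i}) \<le> length Q"
          using adj_root[OF i 3(2)] i by (intro nbrs_on_cycle[OF z]) (auto simp: R_def c_def)
        moreover have "finite {k. R k i}" by (rule finite_subset[of _ "{..<c}"]) (auto simp: R_def)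
        moreover have "i \<notin> {k. R k i}" using 3 by (simp add: R_def)
        ultimately have "b i = 0 \<or> 2 * Suc (b i) \<le> c" by (simp add: b_card c_def)
        then show ?thesis using D c2 w by auto
      qed
    qed
    then have "(\<Sum>i<c. card (nbrs (w i)) + b i) \<le> (\<Sum>i<c. c - 1 + a i)" by (intro sum_mono) auto
    also have "(\<Sum>i<c. c - 1 + a i) = c * (c - 1) + sum a {..<c}" by (simp only: sum.distrib) simp
    finally show "(\<Sum>i<length Q. card (nbrs (w i))) \<le> length Q * (length Q - 1)"
      using ab by (simp add: sum.distrib c_def)
  next

    \<comment> \<open>Long paths between two index sets\<close>
    fix M N assume MN: "M \<subseteq> {..<length Q}" "N \<subseteq> {..<length Q}" "M \<noteq> {}" "N \<noteq> {}"
    have lt: "i < c" if "i \<in> M \<union> N" for i using that MN by (auto simp: c_def)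
    have cM: "card M \<le> c" "card N \<le> c"
      using card_mono[OF _ MN(1)] card_mono[OF _ MN(2)] by (auto simp: c_def)
    consider (apart) i k where "i \<in> M" "k \<in> N" "root i \<noteq> root k" "big (root i) \<or> big (root k)"
      | (group) j where "big j" "M \<subseteq> A j" "N \<subseteq> A j"
      | (low) "\<And>i. i \<in> M \<union> N \<Longrightarrow> \<not> big (root i)"
    proof (cases "\<exists>i\<in>M. \<exists>k\<in>N. root i \<noteq> root k \<and> (big (root i) \<or> big (root k))")
      case False
      show ?thesis
      proof (cases "\<exists>i\<in>M \<union> N. big (root i)")
        case True
        then obtain i where i: "i \<in> M \<union> N" "big (root i)" by auto
        \<comment> \<open>A big root in one of the sets forces the same root on all of the other
          set, and from there on all of the first.\<close>
        have "root a = root i" if "a \<in> M \<union> N" for a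
          using False i that MN(3,4) by (metis Un_iff ex_in_conv)
        then have "M \<union> N \<subseteq> A (root i)" using lt by (auto simp: A_def)
        then show ?thesis using that(2)[OF i(2)] by auto
      qed (use that(3) in blast)
    qed (use that(1) in blast)
    then show "\<exists>i\<in>M. \<exists>k\<in>N. \<exists>zs. path zs \<and> hd zs = w i \<and> last zs = w k \<and> set zs \<subseteq> S \<and>
         card M + card N \<le> 2 * length zs"
    proof cases
      case apart
      have ik: "i < c" "k < c" using apart lt by auto
      from join[OF ik apart(3)] obtain zs where zs: "path zs" "hd zs = w i" "last zs = w k" "set zs \<subseteq> S"
        "length zs + 1 = length (E (root i)) + length (E (root k)) + max (gap i k) (c - gap i k)" by blast
      \<comment> \<open>A big path contains its end and more than \<open>c / 2\<close> neighbours of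
        it. Together with the longer arc of \<open>Q\<close>, which has at least
        \<open>c / 2\<close> edges, this gives at least \<open>c\<close> vertices, enough for any
        \<open>M\<close> and \<open>N\<close>.\<close>
      have long: "c + 2 \<le> 2 * length (E j)" if "big j" for j
      proof -
        have j: "j < length Q" "2 \<le> length (E j)" "length Q < 2 * card (nbrs (last (E j)))"
          using that by (auto simp: big_def c_def)
        have "nbrs (last (E j)) \<subseteq> set (E j)"
          using degree_le_half[OF E j(1,2)] j(3) by force
        then have "card (nbrs (last (E j))) < length (E j)"
          using degree_le_length linkage_path(1)[OF l j(1)] by blast
        then show ?thesis using j by (simp add: c_def)
      qed
      have pos: "0 < length (E (root i))" "0 < length (E (root k))"
        using linkage_path(4)[OF l] root_lt ik by (auto simp: c_def)
      have half: "c \<le> 2 * max (gap i k) (c - gap i k)" by arith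
      have "c + 2 \<le> 2 * length (E (root i)) \<or> c + 2 \<le> 2 * length (E (root k))"
        using apart(4) long by blast
      then have "2 * c \<le> 2 * length zs" using zs(5) pos half by (elim disjE; linarith)
      then show ?thesis using zs apart cM
        by (intro bexI[of _ i] bexI[of _ k] exI[of _ zs]) auto
    next
      case group
      have w: "w i = v j i" if "i \<in> A j" for i using that group by (simp add: w_def A_def)
      have "\<exists>i\<in>M. \<exists>k\<in>N. \<exists>zs. path zs \<and> hd zs = v j i \<and> last zs = v j k \<and> set zs \<subseteq> S \<and>
          card M + card N \<le> 2 * length zs"
        using v[OF group(1), unfolded good_def, THEN conjunct2] group(2,3) MN(3,4) by blast
      then obtain i k zs where ik: "i \<in> M" "k \<in> N" and zs: "path zs" "hd zs = v j i" "last zs = v j k"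
        "set zs \<subseteq> S" "card M + card N \<le> 2 * length zs" by blast
      have "i \<in> A j" "k \<in> A j" using ik group by auto
      then have "hd zs = w i" "last zs = w k" using zs w by simp_all
      with ik zs show ?thesis by blast
    next
      case low
      have rt: "root i = i" if "i \<in> M \<union> N" for i using root_low low that by blast
      show ?thesis
      proof (cases "\<exists>i. M = {i} \<and> N = {i}")
        case True
        then obtain i where i: "M = {i}" "N = {i}" by auto
        have "w i \<in> S" using w_S lt i by simp
        then show ?thesis using i by (auto intro!: exI[of _ "[w i]"] simp: adj_path_def)
      next
        case False
        obtain i k where ik: "i \<in> M" "k \<in> N" "i \<noteq> k"
          "card M + card N \<le> 2 * (max (gap i k) (c - gap i k) + 1)"
          using exists_far_pair[OF MN(1,3,2,4) False] by (auto simp: c_def)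
        have lt': "i < c" "k < c" and "root i \<noteq> root k" using ik lt rt[of i] rt[of k] by auto
        from join[OF this] obtain zs where zs: "path zs" "hd zs = w i" "last zs = w k" "set zs \<subseteq> S"
          "length zs + 1 = length (E (root i)) + length (E (root k)) + max (gap i k) (c - gap i k)" by blast
        have "0 < length (E (root i))" "0 < length (E (root k))"
          using linkage_path(4)[OF l] root_lt lt' by (auto simp: c_def)
        then have "max (gap i k) (c - gap i k) + 1 \<le> length zs" using zs(5) by linarith
        then show ?thesis using zs ik by (intro bexI[of _ i] bexI[of _ k] exI[of _ zs]) auto
      qed
    qed
  qed
qed

end

subsection \<open>The bound on a longest cycle\<close>

context adjacency
begin

text \<open>The integers are used because \<open>d - length Q + 1\<close> may be negative.\<close>

lemma longest_cycle_bound: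
  assumes fin: "finite V" and C: "longest_in V C" and Q: "longest_in (V - set C) Q"
    and deg: "\<And>v. v \<in> V \<Longrightarrow> d \<le> card {y \<in> V. adj v y}"
  shows "(int (length Q) + 1) * (int d - int (length Q) + 1) \<le> int (length C)"
proof -
  interpret H: longest_cycle_system adj "V - set C" Q
    using fin Q by unfold_locales auto
  define c where "c = length Q"
  define n where "n = length C"
  have c1: "0 < c" using H.Q_cycle by (simp add: c_def)
  have cC: "distinct C" "set C \<subseteq> V" using C by (auto simp: longest_in_def adj_cycle_def adj_path_def)
  obtain w :: "nat \<Rightarrow> 'a" where w_H: "\<And>i. i < c \<Longrightarrow> w i \<in> V - set C"
    and w_deg: "(\<Sum>i<c. card (H.nbrs (w i))) \<le> c * (c - 1)"
    and w_path: "\<And>M N. M \<subseteq> {..<c} \<Longrightarrow> N \<subseteq> {..<c} \<Longrightarrow> M \<noteq> {} \<Longrightarrow> N \<noteq> {} \<Longrightarrow>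
       \<exists>i\<in>M. \<exists>k\<in>N. \<exists>zs. path zs \<and> hd zs = w i \<and> last zs = w k \<and> set zs \<subseteq> V - set C \<and>
         card M + card N \<le> 2 * length zs"
    using H.exists_spread_vertices unfolding c_def by blast
  define N where "N i = {p. p < n \<and> adj (w i) (C ! p)}" for i
  have N_deg: "d \<le> card (N i) + card (H.nbrs (w i))" if "i < c" for i
  proof -
    have "d \<le> card {y \<in> V. adj (w i) y}" using deg w_H[OF that] by auto
    also have "{y \<in> V. adj (w i) y} \<subseteq> (\<lambda>p. C ! p) ` N i \<union> H.nbrs (w i)"
      by (auto simp: N_def n_def H.nbrs_def in_set_conv_nth)
    then have "card {y \<in> V. adj (w i) y} \<le> card ((\<lambda>p. C ! p) ` N i \<union> H.nbrs (w i))"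
      by (intro card_mono) (auto simp: N_def)
    also have "\<dots> \<le> card ((\<lambda>p. C ! p) ` N i) + card (H.nbrs (w i))" by (rule card_Un_le)
    also have "card ((\<lambda>p. C ! p) ` N i) \<le> card (N i)" by (intro card_image_le) (simp add: N_def)
    finally show ?thesis by simp
  qed
  define P where "P = (\<Union>i<c. N i)"
  define M where "M p = {i. i < c \<and> p \<in> N i}" for p
  have fP: "finite P" by (auto simp: P_def N_def)
  have M: "M p \<subseteq> {..<c}" "p \<in> P \<Longrightarrow> M p \<noteq> {}" for p by (auto simp: M_def P_def)
  have conn: "\<exists>zs. path zs \<and> set zs \<subseteq> V - set C \<and> adj (C ! p) (hd zs) \<and> adj (last zs) (C ! q) \<and>
      card (M p) + card (M q) \<le> 2 * length zs" if pq: "p \<in> P" "q \<in> P" for p q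
  proof -
    obtain i k zs where "i \<in> M p" "k \<in> M q" "path zs" "hd zs = w i" "last zs = w k"
      "set zs \<subseteq> V - set C" "card (M p) + card (M q) \<le> 2 * length zs"
      using w_path[OF M(1) M(1) M(2)[OF pq(1)] M(2)[OF pq(2)]] by blast
    moreover from this have "adj (C ! p) (w i)" "adj (w k) (C ! q)"
      using adj_sym by (auto simp: M_def N_def)
    ultimately show ?thesis by auto
  qed
  have "(\<Sum>p\<in>P. card (M p) + 1) \<le> n"
  proof (rule sum_le_cycle_length)
    show "P \<subseteq> {..<n}" by (auto simp: P_def N_def)
    show "card (M p) + 1 + (card (M q) + 1) \<le> 2 * gap p q \<and>
        card (M p) + 1 + (card (M q) + 1) + 2 * gap p q \<le> 2 * n"
      if pq: "p \<in> P" "q \<in> P" "p \<noteq> q" for p q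
    proof -
      obtain zs where zs: "path zs" "set zs \<subseteq> V - set C" "adj (C ! p) (hd zs)" "adj (last zs) (C ! q)"
        "card (M p) + card (M q) \<le> 2 * length zs" using conn[OF pq(1,2)] by blast
      have "length zs < gap p q \<and> length zs + gap p q < length C"
        using pq by (intro longest_ear[OF C _ _ pq(3) zs(1-4)]) (auto simp: P_def N_def n_def)
      then show ?thesis using zs(5) by (simp add: n_def)
    qed
    \<comment> \<open>With a single attachment vertex the path closes up to a cycle through
      \<open>C ! p\<close> with \<open>length zs + 1\<close> vertices.\<close>
    show "card (M p) + 1 \<le> n" if "P = {p}" for p
    proof -
      have p: "p \<in> P" "p < length C" using that by (auto simp: P_def N_def n_def)
      obtain zs where zs: "path zs" "set zs \<subseteq> V - set C" "adj (C ! p) (hd zs)" "adj (last zs) (C ! p)"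
        "card (M p) + card (M p) \<le> 2 * length zs" using conn[OF p(1) p(1)] by blast
      have "C ! p \<in> set C" using p by simp
      then have "path ([C ! p] @ zs)"
        using zs by (intro path_append) (auto simp: adj_path_def)
      then have "cyc (C ! p # zs)" using zs by (auto simp: adj_cycle_def adj_path_def)
      moreover have "set (C ! p # zs) \<subseteq> V" using zs(2) \<open>C ! p \<in> set C\<close> cC by auto
      ultimately have "length (C ! p # zs) \<le> length C" using C unfolding longest_in_def by blast
      then show ?thesis using zs(5) by (simp add: n_def)
    qed
  qed
  then have n_ge: "(\<Sum>p\<in>P. card (M p)) + card P \<le> n" by (simp add: sum_Suc)
  have "(\<Sum>p\<in>P. card (M p)) = (\<Sum>p\<in>P. \<Sum>i<c. if p \<in> N i then 1 else 0)"
  proof (rule sum.cong[OF refl])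
    fix p
    have "{..<c} \<inter> {i. p \<in> N i} = M p" by (auto simp: M_def)
    then show "card (M p) = (\<Sum>i<c. if p \<in> N i then 1 else 0)" by (simp add: sum.If_cases)
  qed
  also have "\<dots> = (\<Sum>i<c. \<Sum>p\<in>P. if p \<in> N i then 1 else 0)" by (rule sum.swap)
  also have "\<dots> = (\<Sum>i<c. card (N i))"
  proof (rule sum.cong[OF refl])
    fix i assume "i \<in> {..<c}"
    then have "P \<inter> {p. p \<in> N i} = N i" by (auto simp: P_def)
    then show "(\<Sum>p\<in>P. if p \<in> N i then 1 else 0) = card (N i)" using fP by (simp add: sum.If_cases)
  qed
  finally have M_sum: "(\<Sum>p\<in>P. card (M p)) = (\<Sum>i<c. card (N i))" .
  have "c * d \<le> (\<Sum>i<c. card (N i) + card (H.nbrs (w i)))"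
    using sum_mono[of "{..<c}" "\<lambda>_. d" "\<lambda>i. card (N i) + card (H.nbrs (w i))"] N_deg by simp
  then have A: "c * d \<le> (\<Sum>i<c. card (N i)) + c * (c - 1)" using w_deg by (simp add: sum.distrib)
  \<comment> \<open>The average degree of the \<open>w i\<close> is at most \<open>c - 1\<close>, so
    some \<open>w i\<close> does not exceed it; its neighbours on \<open>C\<close> alone give
    \<open>d \<le> card P + (c - 1)\<close>.\<close>
  have "\<exists>i<c. card (H.nbrs (w i)) \<le> c - 1"
  proof (rule ccontr)
    assume "\<not> ?thesis"
    then have "(\<Sum>i<c. c) \<le> (\<Sum>i<c. card (H.nbrs (w i)))" by (intro sum_mono) (auto simp: not_le)
    also note w_deg
    finally show False using c1 by simp
  qed
  then obtain i where i: "i < c" "card (H.nbrs (w i)) \<le> c - 1" by auto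
  have "N i \<subseteq> P" using i by (auto simp: P_def)
  then have "card (N i) \<le> card P" using fP by (intro card_mono)
  then have B: "d \<le> card P + (c - 1)" using N_deg[OF i(1)] i(2) by linarith
  \<comment> \<open>Writing \<open>c\<close> as \<open>Suc m\<close> removes the truncated
    subtraction before the passage to the integers.\<close>
  obtain m where m: "c = Suc m" using c1 gr0_conv_Suc by auto
  have "c * d + d \<le> n + c * m + m" using A B n_ge M_sum m by simp
  then have "int (c * d + d) \<le> int (n + c * m + m)" by (simp only: of_nat_le_iff)
  moreover have "length Q = Suc m" "length C = n" using m by (simp_all add: c_def n_def)
  ultimately show ?thesis using m by (simp add: algebra_simps)
qed

end

section \<open>Translating cycles and degrees of digraphs to the adjacency relation\<close>

lemma set_vwalk_arcs_subset:
  "set (vwalk_arcs xs) \<subseteq> arcs_ends G \<longleftrightarrow> successively (\<lambda>u v. u \<rightarrow>\<^bsub>G\<^esub> v) xs"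
  by (induction xs rule: vwalk_arcs.induct) auto

lemma cycle_verts_iff_adj_cycle:
  assumes "graph G"
  shows "cycle_verts G C \<longleftrightarrow> adj_cycle (\<lambda>u v. u \<rightarrow>\<^bsub>G\<^esub> v) C \<and> set C \<subseteq> verts G"
  unfolding cycle_verts_iff_vpath[OF assms]
  by (auto simp: vpath_def vwalk_def set_vwalk_arcs_subset adj_cycle_def adj_path_def)

lemma graph_induce_subgraph:
  assumes "graph G" "W \<subseteq> verts G"
  shows "graph (G \<restriction> W)"
proof -
  interpret graph G by fact
  show ?thesis
  proof
    show "finite (verts (G \<restriction> W))" using finite_subset[OF assms(2) finite_verts] by simp
    show "symmetric (G \<restriction> W)"
      using sym_arcs by (fastforce simp: symmetric_def sym_def arcs_ends_conv)
  qed (auto dest: no_loops intro: no_multi_arcs)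
qed

lemma dominates_induce_subgraph:
  "u \<rightarrow>\<^bsub>G \<restriction> W\<^esub> v \<longleftrightarrow> u \<rightarrow>\<^bsub>G\<^esub> v \<and> u \<in> W \<and> v \<in> W"
  by (auto simp: arcs_ends_conv)

text \<open>For \<open>W = verts G - set C\<close> this turns the longest cycles of the remaining
  graph into those of \<open>longest_in W\<close>, over the adjacency of \<open>G\<close>
  itself.\<close>

lemma cycle_verts_induce_subgraph:
  assumes "graph G" "W \<subseteq> verts G"
  shows "cycle_verts (G \<restriction> W) C \<longleftrightarrow> adj_cycle (\<lambda>u v. u \<rightarrow>\<^bsub>G\<^esub> v) C \<and> set C \<subseteq> W"
proof -
  have "successively (\<lambda>u v. u \<rightarrow>\<^bsub>G \<restriction> W\<^esub> v) C \<longleftrightarrow> successively (\<lambda>u v. u \<rightarrow>\<^bsub>G\<^esub> v) C" if "set C \<subseteq> W"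
    using that by (intro successively_cong) (auto simp: dominates_induce_subgraph)
  moreover have "last C \<in> W \<and> hd C \<in> W" if "set C \<subseteq> W" "C \<noteq> []"
    using that by auto
  ultimately show ?thesis
    unfolding cycle_verts_iff_adj_cycle[OF graph_induce_subgraph[OF assms]]
    by (auto simp: adj_cycle_def adj_path_def dominates_induce_subgraph)
qed

lemma (in graph) out_degree_eq_card_dominates:
  "out_degree G v = card {u \<in> verts G. v \<rightarrow>\<^bsub>G\<^esub> u}"
proof -
  have "inj_on (head G) (out_arcs G v)"
    using no_multi_arcs by (auto simp: inj_on_def arc_to_ends_def)
  moreover have "head G ` out_arcs G v = {u \<in> verts G. v \<rightarrow>\<^bsub>G\<^esub> u}"
    by (auto simp: arcs_ends_conv image_iff)
  ultimately show ?thesis unfolding out_degree_def by (metis card_image)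
qed

lemma longest_cycle_ge:
  assumes G: "graph G" and C: "longest_cycle G C"
    and c: "c = longest_cycle_length (G \<restriction> (verts G - set C))"
  shows "(int c + 1) * (int (min_degree G) - int c + 1) \<le> int (length C)"
proof -
  interpret graph G by fact
  interpret adjacency "\<lambda>u v. u \<rightarrow>\<^bsub>G\<^esub> v"
    by unfold_locales (auto intro: graph_symmetric dest: adj_not_same)
  let ?W = "verts G - set C"
  have longC: "longest_in (verts G) C"
    using C by (auto simp: longest_cycle_def longest_in_def cycle_verts_iff_adj_cycle[OF G])
  have C_sub: "set C \<subseteq> verts G" and C_ne: "C \<noteq> []" and C_dist: "distinct C"
    using longC by (auto simp: longest_in_def adj_cycle_def adj_path_def)
  have deg: "min_degree G \<le> card {y \<in> verts G. v \<rightarrow>\<^bsub>G\<^esub> y}" if "v \<in> verts G" for v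
    using that finite_verts unfolding min_degree_def
    by (auto simp: out_degree_eq_card_dominates[symmetric] intro!: Min_le)
  show ?thesis
  proof (cases "?W = {}")
    case True
    \<comment> \<open>By convention \<open>c = 0\<close>. As \<open>C\<close> spans
      \<open>G\<close>, it remains to see that the minimum degree is less than the number of
      vertices.\<close>
    then have "c = 0" using c by (simp add: longest_cycle_length_def)
    have V: "verts G = set C" using True C_sub by auto
    obtain v where v: "v \<in> verts G" using C_ne V by (cases C) auto
    have "min_degree G \<le> card {y \<in> verts G. v \<rightarrow>\<^bsub>G\<^esub> y}" using deg[OF v] .
    also have "\<dots> \<le> card (verts G - {v})"
      using finite_verts by (intro card_mono) (auto dest: adj_not_same)
    also have "\<dots> < card (verts G)" using v finite_verts by (intro card_Diff1_less)
    also have "\<dots> = length C" using V C_dist by (simp add: distinct_card)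
    finally show ?thesis using \<open>c = 0\<close> by simp
  next
    case False
    have H: "graph (G \<restriction> ?W)" by (rule graph_induce_subgraph[OF G]) auto
    obtain Q where Q: "longest_cycle (G \<restriction> ?W) Q"
      using longest_cycle_exists[OF H] False by auto
    have "c = length Q" using longest_cycle_length_eq[OF H Q] c by simp
    moreover have "longest_in ?W Q"
      using Q by (auto simp: longest_cycle_def longest_in_def cycle_verts_induce_subgraph[OF G])
    ultimately show ?thesis
      using longest_cycle_bound[OF finite_verts longC _ deg] by simp
  qed
qed

theorem theorem6:
  fixes G :: "('a, 'b) pre_digraph" and lam :: int and \<delta> cbar :: nat and C :: "'a list"
  assumes "graph G"
    and "\<delta> = min_degree G"
    and "longest_cycle G C"
    and "cbar = longest_cycle_length (G \<restriction> (verts G - set C))"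
    and "min (lam - 1) (int \<delta> - lam + 1) \<le> int cbar"
    and "int cbar \<le> max (lam - 1) (int \<delta> - lam + 1)"
  shows "int (length C) \<ge> lam * (int \<delta> - lam + 2)"
proof -
  have "(int cbar + 1) * (int \<delta> - int cbar + 1) \<le> int (length C)"
    using longest_cycle_ge[OF assms(1,3,4)] assms(2) by simp
  \<comment> \<open>The concave function \<open>t * (\<delta> + 2 - t)\<close> takes the value
    \<open>lam * (\<delta> - lam + 2)\<close> at both \<open>lam\<close> and
    \<open>\<delta> - lam + 2\<close>, and \<open>cbar + 1\<close> lies between them. The product is
    the difference of its values at \<open>cbar + 1\<close> and at \<open>lam\<close>.\<close>
  moreover have "0 \<le> (int cbar + 1 - lam) * (int \<delta> - lam + 1 - int cbar)"
    using assms(5,6) by (auto simp: zero_le_mult_iff min_def max_def split: if_splits)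
  then have "lam * (int \<delta> - lam + 2) \<le> (int cbar + 1) * (int \<delta> - int cbar + 1)"
    by (simp add: algebra_simps)
  ultimately show ?thesis by linarith
qed

end
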